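(* Let $\Pi\in\mathbb{C}^{n\times n}$ be the (smallest) nonnegative self-adjoint solution of the control algebraic Riccati equation $$A_d^*\Pi A_d-\Pi+C_d^*C_d=V^*P^{-1}V,\qquad P:=I+D_d^*D_d+B_d^*\Pi B_d,\quad V:=D_d^*C_d+B_d^*\Pi A_d .$$ Let $S=\left[\begin{smallmatrix}A\& B\\ C\& D\end{smallmatrix}\right]$ with domain $D(S)$ be the system node described in the context, and let $R=I_U$. Define $Z:=\Pi I_X\in\mathcal{L}(X)$, i.e. $(Zz)(\zeta)=\Pi z(\zeta)$, and $K\& L:D(S)\to U$ by $$K\& L\begin{bmatrix}z\\ u\end{bmatrix}=P^{-\frac12}V(\lambda_0z)(1)+P^{\frac12}u .$$ Then $Z$ and $K\& L$ are a solution of the operator node Riccati equation for $S$; that is, $Z=Z^*$ and for all $\begin{bmatrix}z\\ u\end{bmatrix}\in D(S)$, $$\left\langle A\& B\begin{bmatrix}z\\ u\end{bmatrix},Zz\right\rangle_X+\left\langle Zz,A\& B\begin{bmatrix}z\\ u\end{bmatrix}\right\rangle_X+\left\Vert C\& D\begin{bmatrix}z\\ u\end{bmatrix}\right\Vert_Y^2+\langle Ru,u\rangle_U=\left\Vert K\& L\begin{bmatrix}z\\ u\end{bmatrix}\right\Vert_U^2 .$$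
   Context: Let $n,p,m$ be positive integers with $p\le n$, and let $\lambda_0:[0,1]\to\mathbb{R}$ be a bounded measurable function with $\lambda_0(\cdot)\ge\epsilon>0$ for some constant $\epsilon$. Let $X:=\mathrm{L}^2(0,1;\mathbb{C}^n)$ with inner product $\langle f,g\rangle_X:=\int_0^1 g^*(\zeta)\lambda_0(\zeta)f(\zeta)\,\mathrm{d}\zeta$, and let $U:=\mathbb{C}^p$, $Y:=\mathbb{C}^m$ with their standard inner products. Let $K,L\in\mathbb{C}^{n\times n}$ and $K_y,L_y\in\mathbb{C}^{m\times n}$ be matrices with $K$ invertible. They define the boundary controlled and observed PDE $\partial_t z=-\partial_\zeta(\lambda_0z)$ on $[0,1]$ with $\left[\begin{smallmatrix}0\\ I\end{smallmatrix}\right]u(t)=-K\lambda_0(0)z(0,t)-L\lambda_0(1)z(1,t)$ and $y(t)=-K_y\lambda_0(0)z(0,t)-L_y\lambda_0(1)z(1,t)$. Here $\left[\begin{smallmatrix}0\\ I\end{smallmatrix}\right]\in\mathbb{C}^{n\times p}$ has the $p\times p$ identity as its last $p$ rows. Set $$A_d:=-K^{-1}L,\quad B_d:=-K^{-1}\left[\begin{smallmatrix}0\\ I\end{smallmatrix}\right],\quad C_d:=K_yK^{-1}L-L_y,\quad D_d:=K_yK^{-1}\left[\begin{smallmatrix}0\\ I\end{smallmatrix}\right].$$ The system node $S$ associated with this system is $$S\begin{bmatrix}z\\ u\end{bmatrix}=\begin{bmatrix}A\& B\\ C\& D\end{bmatrix}\begin{bmatrix}z\\ u\end{bmatrix}=\begin{bmatrix}-\frac{\mathrm{d}}{\mathrm{d}\zeta}(\lambda_0z)\\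 C_d(\lambda_0z)(1)+D_du\end{bmatrix},$$ $$D(S)=\left\{\begin{bmatrix}z\\ u\end{bmatrix}\in X\times\mathbb{C}^p:\ \lambda_0z\in\mathrm{H}^1(0,1;\mathbb{C}^n),\ (\lambda_0z)(0)-A_d(\lambda_0z)(1)=B_du\right\}.$$ The values $(\lambda_0z)(0)$, $(\lambda_0z)(1)$ are those of the continuous representative of $\lambda_0z$. The symbols $A\& B$, $C\& D$, $K\& L$ each denote a single operator on $D(S)$. Given $R=R^*>0$ on $U$, operators $Z=Z^*\in\mathcal{L}(X)$ and $K\& L:D(S)\to U$ are called a solution of the operator node Riccati equation for $S$ if the displayed identity in the claim holds for all $\begin{bmatrix}z\\ u\end{bmatrix}\in D(S)$. "Nonnegative" means positive semidefinite Hermitian; "smallest" is with respect to the usual order of Hermitian matrices among nonnegative solutions. *)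

theory Defs
  imports "HOL-Analysis.Analysis"
begin

text \<open>Standard inner product \<open>w\<^sup>* v\<close> of \<open>\<complex>\<^sup>n\<close>, linear in the first argument.\<close>

definition cinner :: "complex^'k \<Rightarrow> complex^'k \<Rightarrow> complex" where
  "cinner v w = (\<Sum>i\<in>UNIV. cnj (w $ i) * v $ i)"

definition adjoint_mat :: "complex^'k^'l \<Rightarrow> complex^'l^'k" where
  "adjoint_mat A = (\<chi> i j. cnj (A $ j $ i))"

definition hermitian :: "complex^'k^'k \<Rightarrow> bool" where
  "hermitian A \<longleftrightarrow> adjoint_mat A = A"

text \<open>For a Hermitian \<open>A\<close> the number \<open>x\<^sup>* A x\<close> is real, so taking the real part loses nothing.\<close>

definition nonneg_mat :: "complex^'k^'k \<Rightarrow> bool" where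
  "nonneg_mat A \<longleftrightarrow> hermitian A \<and> (\<forall>x. 0 \<le> Re (cinner (A *v x) x))"

definition pos_mat :: "complex^'k^'k \<Rightarrow> bool" where
  "pos_mat A \<longleftrightarrow> hermitian A \<and> (\<forall>x. x \<noteq> 0 \<longrightarrow> 0 < Re (cinner (A *v x) x))"

definition le_mat :: "complex^'k^'k \<Rightarrow> complex^'k^'k \<Rightarrow> bool" where
  "le_mat A B \<longleftrightarrow> nonneg_mat (B - A)"

text \<open>The square root \<open>A\<^bsup>1/2\<^esup>\<close>; meaningful for nonnegative \<open>A\<close>.\<close>

definition sqrt_mat :: "complex^'k^'k \<Rightarrow> complex^'k^'k" where
  "sqrt_mat A = (THE Q. nonneg_mat Q \<and> Q ** Q = A)"

text \<open>
  Matrix indices range over finite linearly ordered types, so that ``the last rows'' makes sense.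
  \<open>index_pos i\<close> is the zero-based position of \<open>i\<close>, and \<open>bottom_id\<close> is the matrix with rows
  \<open>0\<close> on top of an identity matrix (for \<open>CARD('p) \<le> CARD('n)\<close>).
\<close>

definition index_pos :: "'k::{finite,linorder} \<Rightarrow> nat" where
  "index_pos i = card {j. j < i}"

definition bottom_id :: "complex^'p::{finite,linorder}^'n::{finite,linorder}" where
  "bottom_id = (\<chi> i j. if index_pos i = (CARD('n) - CARD('p)) + index_pos j then 1 else 0)"

definition disc_A :: "complex^'n^'n \<Rightarrow> complex^'n^'n \<Rightarrow> complex^'n^'n" where
  "disc_A K L = - (matrix_inv K ** L)"

definition disc_B ::
  "complex^'n::{finite,linorder}^'n::{finite,linorder} \<Rightarrow>
   complex^'p::{finite,linorder}^'n::{finite,linorder}" where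
  "disc_B K = - (matrix_inv K ** bottom_id)"

definition disc_C ::
  "complex^'n^'n \<Rightarrow> complex^'n^'n \<Rightarrow> complex^'n^'m \<Rightarrow> complex^'n^'m \<Rightarrow> complex^'n^'m" where
  "disc_C K L Ky Ly = Ky ** matrix_inv K ** L - Ly"

definition disc_D ::
  "complex^'n::{finite,linorder}^'n::{finite,linorder} \<Rightarrow> complex^'n::{finite,linorder}^'m \<Rightarrow>
   complex^'p::{finite,linorder}^'m" where
  "disc_D K Ky = Ky ** matrix_inv K ** bottom_id"

definition care_P :: "complex^'p^'n \<Rightarrow> complex^'p^'m \<Rightarrow> complex^'n^'n \<Rightarrow> complex^'p^'p" where
  "care_P B D \<Pi>\<^sub>0 = mat 1 + adjoint_mat D ** D + adjoint_mat B ** \<Pi>\<^sub>0 ** B"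

definition care_V ::
  "complex^'n^'n \<Rightarrow> complex^'p^'n \<Rightarrow> complex^'n^'m \<Rightarrow> complex^'p^'m \<Rightarrow> complex^'n^'n \<Rightarrow> complex^'n^'p" where
  "care_V A B C D \<Pi>\<^sub>0 = adjoint_mat D ** C + adjoint_mat B ** \<Pi>\<^sub>0 ** A"

definition care_solution ::
  "complex^'n^'n \<Rightarrow> complex^'p^'n \<Rightarrow> complex^'n^'m \<Rightarrow> complex^'p^'m \<Rightarrow> complex^'n^'n \<Rightarrow> bool" where
  "care_solution A B C D \<Pi>\<^sub>0 \<longleftrightarrow> nonneg_mat \<Pi>\<^sub>0 \<and>
     adjoint_mat A ** \<Pi>\<^sub>0 ** A - \<Pi>\<^sub>0 + adjoint_mat C ** C =
       adjoint_mat (care_V A B C D \<Pi>\<^sub>0) ** matrix_inv (care_P B D \<Pi>\<^sub>0) ** care_V A B C D \<Pi>\<^sub>0"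

definition care_smallest_solution ::
  "complex^'n^'n \<Rightarrow> complex^'p^'n \<Rightarrow> complex^'n^'m \<Rightarrow> complex^'p^'m \<Rightarrow> complex^'n^'n \<Rightarrow> bool" where
  "care_smallest_solution A B C D \<Pi>\<^sub>0 \<longleftrightarrow> care_solution A B C D \<Pi>\<^sub>0 \<and>
     (\<forall>\<Pi>\<^sub>1. care_solution A B C D \<Pi>\<^sub>1 \<longrightarrow> le_mat \<Pi>\<^sub>0 \<Pi>\<^sub>1)"

text \<open>
  Elements of \<open>L\<^sup>2\<close> are represented by functions; equality in \<open>L\<^sup>2\<close> is equality almost everywhere
  on \<open>[0,1]\<close>. Values outside \<open>[0,1]\<close> are irrelevant.
\<close>

definition L2_01 :: "(real \<Rightarrow> complex^'n) set" where
  "L2_01 = {f. f \<in> borel_measurable (lebesgue_on {0..1}) \<and>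
               integrable (lebesgue_on {0..1}) (\<lambda>\<zeta>. (norm (f \<zeta>))\<^sup>2)}"

definition ae_eq_01 :: "(real \<Rightarrow> 'a) \<Rightarrow> (real \<Rightarrow> 'a) \<Rightarrow> bool" where
  "ae_eq_01 f g \<longleftrightarrow> (AE \<zeta> in lebesgue_on {0..1}. f \<zeta> = g \<zeta>)"

text \<open>
  Under the standing assumptions on the weight \<open>lam\<close>, that is \<open>\<lambda>\<^sub>0\<close> (measurable, bounded, bounded away from zero)
  the weighted space \<open>X\<close> is \<open>L2_01\<close> as a set, with the following inner product and norm.
\<close>

definition inner_X :: "(real \<Rightarrow> real) \<Rightarrow> (real \<Rightarrow> complex^'n) \<Rightarrow> (real \<Rightarrow> complex^'n) \<Rightarrow> complex" where
  "inner_X lam f g =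
     integral\<^sup>L (lebesgue_on {0..1}) (\<lambda>\<zeta>. complex_of_real (lam \<zeta>) * cinner (f \<zeta>) (g \<zeta>))"

definition norm_X :: "(real \<Rightarrow> real) \<Rightarrow> (real \<Rightarrow> complex^'n) \<Rightarrow> real" where
  "norm_X lam f = sqrt (Re (inner_X lam f f))"

text \<open>
  The test functions \<open>\<phi>\<close> (with derivative \<open>\<phi>'\<close>) for weak derivatives on \<open>(0,1)\<close> are the
  \<open>C\<^sup>1\<close> functions with compact support in \<open>(0,1)\<close>.
\<close>

definition test_fun :: "(real \<Rightarrow> real) \<Rightarrow> (real \<Rightarrow> real) \<Rightarrow> bool" where
  "test_fun \<phi> \<phi>' \<longleftrightarrow> (\<forall>x. (\<phi> has_real_derivative \<phi>' x) (at x)) \<and> continuous_on UNIV \<phi>' \<and>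
     (\<exists>a>0. \<exists>b<1. \<forall>x. x \<notin> {a..b} \<longrightarrow> \<phi> x = 0)"

definition has_weak_deriv :: "(real \<Rightarrow> complex^'n) \<Rightarrow> (real \<Rightarrow> complex^'n) \<Rightarrow> bool" where
  "has_weak_deriv w h \<longleftrightarrow> (\<forall>\<phi> \<phi>'. test_fun \<phi> \<phi>' \<longrightarrow>
     integral\<^sup>L (lebesgue_on {0..1}) (\<lambda>\<zeta>. \<phi>' \<zeta> *\<^sub>R w \<zeta>) =
     - integral\<^sup>L (lebesgue_on {0..1}) (\<lambda>\<zeta>. \<phi> \<zeta> *\<^sub>R h \<zeta>))"

definition H1_01 :: "(real \<Rightarrow> complex^'n) set" where
  "H1_01 = {w \<in> L2_01. \<exists>h\<in>L2_01. has_weak_deriv w h}"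

text \<open>
  For \<open>w \<in> H1_01\<close>, the weak derivative is unique up to almost everywhere equality, and the
  continuous representative is unique on \<open>[0,1]\<close>; so the choices below do not matter.
\<close>

definition weak_deriv :: "(real \<Rightarrow> complex^'n) \<Rightarrow> (real \<Rightarrow> complex^'n)" where
  "weak_deriv w = (SOME h. h \<in> L2_01 \<and> has_weak_deriv w h)"

definition cont_rep :: "(real \<Rightarrow> complex^'n) \<Rightarrow> (real \<Rightarrow> complex^'n)" where
  "cont_rep w = (SOME v. continuous_on {0..1} v \<and> ae_eq_01 v w)"

text \<open>Linear bounded operators \<open>X \<rightarrow> X\<close>; since \<open>X\<close> consists of classes, linearity is required
  almost everywhere, and boundedness then yields compatibility with almost everywhere equality.\<close>

definition bounded_op_X :: "(real \<Rightarrow> real) \<Rightarrow> ((real \<Rightarrow> complex^'n) \<Rightarrow> (real \<Rightarrow> complex^'n)) \<Rightarrow> bool" where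
  "bounded_op_X lam Z \<longleftrightarrow>
     (\<forall>f\<in>L2_01. Z f \<in> L2_01) \<and>
     (\<forall>f\<in>L2_01. \<forall>g\<in>L2_01. \<forall>a b.
        ae_eq_01 (Z (\<lambda>\<zeta>. a *s f \<zeta> + b *s g \<zeta>)) (\<lambda>\<zeta>. a *s Z f \<zeta> + b *s Z g \<zeta>)) \<and>
     (\<exists>M. \<forall>f\<in>L2_01. norm_X lam (Z f) \<le> M * norm_X lam f)"

definition self_adjoint_X :: "(real \<Rightarrow> real) \<Rightarrow> ((real \<Rightarrow> complex^'n) \<Rightarrow> (real \<Rightarrow> complex^'n)) \<Rightarrow> bool" where
  "self_adjoint_X lam Z \<longleftrightarrow>
     (\<forall>f\<in>L2_01. \<forall>g\<in>L2_01. inner_X lam (Z f) g = inner_X lam f (Z g))"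

definition weighted :: "(real \<Rightarrow> real) \<Rightarrow> (real \<Rightarrow> complex^'n) \<Rightarrow> (real \<Rightarrow> complex^'n)" where
  "weighted lam z = (\<lambda>\<zeta>. lam \<zeta> *\<^sub>R z \<zeta>)"

definition boundary_value :: "(real \<Rightarrow> real) \<Rightarrow> (real \<Rightarrow> complex^'n) \<Rightarrow> real \<Rightarrow> complex^'n" where
  "boundary_value lam z \<zeta> = cont_rep (weighted lam z) \<zeta>"

definition node_dom ::
  "(real \<Rightarrow> real) \<Rightarrow> complex^'n^'n \<Rightarrow> complex^'p^'n \<Rightarrow> ((real \<Rightarrow> complex^'n) \<times> (complex^'p)) set" where
  "node_dom lam A B = {(z, u). z \<in> L2_01 \<and> weighted lam z \<in> H1_01 \<and>
     boundary_value lam z 0 - A *v boundary_value lam z 1 = B *v u}"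

definition node_op ::
  "(real \<Rightarrow> real) \<Rightarrow> complex^'n^'m \<Rightarrow> complex^'p^'m \<Rightarrow>
   (real \<Rightarrow> complex^'n) \<times> (complex^'p) \<Rightarrow> (real \<Rightarrow> complex^'n) \<times> (complex^'m)" where
  "node_op lam C D = (\<lambda>(z, u).
     ((\<lambda>\<zeta>. - weak_deriv (weighted lam z) \<zeta>), C *v boundary_value lam z 1 + D *v u))"

text \<open>The second conjunct makes \<open>T\<close> well defined on almost everywhere equality classes.\<close>

definition linear_op_on ::
  "((real \<Rightarrow> complex^'n) \<times> (complex^'p)) set \<Rightarrow>
   ((real \<Rightarrow> complex^'n) \<times> (complex^'p) \<Rightarrow> complex^'q) \<Rightarrow> bool" where
  "linear_op_on Dom T \<longleftrightarrow>
     (\<forall>z u z' u'. (z, u) \<in> Dom \<longrightarrow> (z', u') \<in> Dom \<longrightarrow>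
        (\<forall>a b. T ((\<lambda>\<zeta>. a *s z \<zeta> + b *s z' \<zeta>), a *s u + b *s u') = a *s T (z, u) + b *s T (z', u'))) \<and>
     (\<forall>z z' u. (z, u) \<in> Dom \<longrightarrow> (z', u) \<in> Dom \<longrightarrow> ae_eq_01 z z' \<longrightarrow> T (z, u) = T (z', u))"

text \<open>
  For a node \<open>S\<close> with domain \<open>Dom\<close>, the components \<open>fst (S x)\<close> and \<open>snd (S x)\<close> are
  \<open>A&B x\<close> and \<open>C&D x\<close>.
\<close>

definition riccati_solution ::
  "(real \<Rightarrow> real) \<Rightarrow> ((real \<Rightarrow> complex^'n) \<times> (complex^'p)) set \<Rightarrow>
   ((real \<Rightarrow> complex^'n) \<times> (complex^'p) \<Rightarrow> (real \<Rightarrow> complex^'n) \<times> (complex^'m)) \<Rightarrow>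
   complex^'p^'p \<Rightarrow>
   ((real \<Rightarrow> complex^'n) \<Rightarrow> (real \<Rightarrow> complex^'n)) \<Rightarrow>
   ((real \<Rightarrow> complex^'n) \<times> (complex^'p) \<Rightarrow> complex^'p) \<Rightarrow> bool" where
  "riccati_solution lam Dom S R Z KL \<longleftrightarrow>
     pos_mat R \<and> bounded_op_X lam Z \<and> self_adjoint_X lam Z \<and> linear_op_on Dom KL \<and>
     (\<forall>z u. (z, u) \<in> Dom \<longrightarrow>
        inner_X lam (fst (S (z, u))) (Z z) + inner_X lam (Z z) (fst (S (z, u)))
        + complex_of_real ((norm (snd (S (z, u))))\<^sup>2) + cinner (R *v u) u
        = complex_of_real ((norm (KL (z, u)))\<^sup>2))"

end

theory Submission
  imports Defs
begin

text \<open>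
  Put \<open>w = lam z\<close>. Since \<open>w\<close> is in \<open>H\<^sup>1\<close>, it agrees almost everywhere with a primitive \<open>g\<close> of its weak
  derivative \<open>h\<close> (du Bois-Reymond), and Fubini's theorem gives integration by parts for primitives
  of integrable functions. The weight in the inner product of \<open>X\<close> turns \<open>z\<close> into \<open>w\<close>, so the two
  inner products in the Riccati equation add up to \<open>g(0)\<^sup>* \<Pi> g(0) - g(1)\<^sup>* \<Pi> g(1)\<close>. Substituting
  \<open>g(0) = A g(1) + B u\<close> leaves a finite-dimensional identity, which is the completion of the square
  in the control algebraic Riccati equation. It uses that \<open>P\<close> dominates the identity and
  therefore has a unique nonnegative square root, which is invertible.
\<close>

section \<open>Complex matrices and positive square roots\<close>

text \<open>The objects of the statement come from choice operators: \<open>weak_deriv\<close>,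
  \<open>cont_rep\<close> and \<open>matrix_inv\<close> by \<open>SOME\<close>,
  \<open>sqrt_mat\<close> by \<open>THE\<close>. Nothing can be computed with them until existence
  is known, together with uniqueness or a property shared by all candidates; most of the analysis
  serves this purpose. The weight is merely measurable and \<open>z\<close> itself may have no
  continuity at all, so no product rule is available: \<open>lam\<close> and \<open>z\<close> are
  never differentiated separately, only their product is. Since test functions are only required to
  be of class C^1, their derivatives are merely continuous. The density arguments can therefore work
  with clamped and truncated continuous functions, without mollifiers. Likewise the square root is
  built from norm estimates and completeness alone, without eigenvalues.\<close>

lemma Re_cinner: "Re (cinner v w) = v \<bullet> w"
  by (simp add: cinner_def inner_vec_def inner_complex_def sum.distrib algebra_simps)

lemma cinner_self: "cinner v v = complex_of_real ((norm v)\<^sup>2)"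
proof -
  have "(norm v)\<^sup>2 = (\<Sum>i\<in>UNIV. (cmod (v $ i))\<^sup>2)"
    by (simp add: norm_vec_def L2_set_def sum_nonneg)
  then show ?thesis
    unfolding cinner_def by (simp add: complex_norm_square mult.commute del: of_real_power)
qed

lemma cinner_add_left: "cinner (v + v') w = cinner v w + cinner v' w"
  and cinner_add_right: "cinner v (w + w') = cinner v w + cinner v w'"
  and cinner_diff_left: "cinner (v - v') w = cinner v w - cinner v' w"
  and cinner_minus_left: "cinner (- v) w = - cinner v w"
  and cinner_minus_right: "cinner v (- w) = - cinner v w"
  and cinner_scaleR_left: "cinner (r *\<^sub>R v) w = of_real r * cinner v w"
  and cinner_scaleR_right: "cinner v (r *\<^sub>R w) = of_real r * cinner v w"
  unfolding cinner_def vector_scaleR_component scaleR_conv_of_real[where 'a = complex]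
  by (simp_all add: sum.distrib sum_subtractf sum_negf sum_distrib_left algebra_simps)

lemma cinner_axis: "cinner v (axis i 1) = v $ i"
proof -
  have "cnj (axis i 1 $ j) * v $ j = (if j = i then v $ j else 0)" for j
    by (simp add: axis_def)
  then show ?thesis by (simp add: cinner_def)
qed

lemma matrix_vector_mult_axis: "(A :: complex^'n^'m) *v axis i 1 = column i A"
proof -
  have "A $ k $ j * axis i 1 $ j = (if j = i then A $ k $ j else 0)" for j k
    by (simp add: axis_def)
  then show ?thesis by (simp add: matrix_vector_mult_def column_def)
qed

lemma cinner_matrix_left: "cinner (A *v x) y = cinner x (adjoint_mat A *v y)"
proof -
  have "cinner (A *v x) y = (\<Sum>i\<in>UNIV. \<Sum>j\<in>UNIV. cnj (y $ i) * (A $ i $ j * x $ j))"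
    by (simp add: cinner_def matrix_vector_mult_def sum_distrib_left)
  also have "\<dots> = (\<Sum>j\<in>UNIV. \<Sum>i\<in>UNIV. cnj (y $ i) * (A $ i $ j * x $ j))"
    by (rule sum.swap)
  also have "\<dots> = cinner x (adjoint_mat A *v y)"
    by (simp add: cinner_def matrix_vector_mult_def adjoint_mat_def sum_distrib_left sum_distrib_right algebra_simps)
  finally show ?thesis .
qed

lemma adjoint_mat_adjoint_mat [simp]: "adjoint_mat (adjoint_mat A) = A"
  by (simp add: adjoint_mat_def vec_eq_iff)

lemma cinner_matrix_right: "cinner x (A *v y) = cinner (adjoint_mat A *v x) y"
  by (simp add: cinner_matrix_left)

lemma adjoint_mat_mult: "adjoint_mat (A ** B) = adjoint_mat B ** adjoint_mat A"
  by (simp add: adjoint_mat_def matrix_matrix_mult_def vec_eq_iff mult.commute)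

lemma adjoint_mat_add: "adjoint_mat (A + B) = adjoint_mat A + adjoint_mat B"
  and adjoint_mat_diff: "adjoint_mat (A - B) = adjoint_mat A - adjoint_mat B"
  and adjoint_mat_scaleR: "adjoint_mat (r *\<^sub>R A) = r *\<^sub>R adjoint_mat A"
  by (simp_all add: adjoint_mat_def vec_eq_iff)

lemma adjoint_mat_one [simp]: "adjoint_mat (mat 1) = mat 1"
  by (auto simp add: adjoint_mat_def mat_def vec_eq_iff)

lemma matrix_mult_scaleR_left: "(r *\<^sub>R A) ** B = r *\<^sub>R (A ** (B :: complex^'n^'k))"
  and matrix_mult_scaleR_right: "A ** (r *\<^sub>R B) = r *\<^sub>R (A ** (B :: complex^'n^'k))"
  and matrix_vector_mult_scaleR_left: "(r *\<^sub>R A) *v x = r *\<^sub>R ((A :: complex^'k^'m) *v x)"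
  and matrix_vector_mult_scaleR_right: "A *v (r *\<^sub>R x) = r *\<^sub>R ((A :: complex^'k^'m) *v x)"
  and matrix_vector_mult_minus_right: "A *v (- x) = - ((A :: complex^'k^'m) *v x)"
  by (simp_all add: matrix_matrix_mult_def matrix_vector_mult_def vec_eq_iff scaleR_sum_right sum_negf)

lemma matrix_mult_diff_left: "A ** (B - B') = A ** B - A ** (B' :: complex^'n^'k)"
  and matrix_mult_diff_right: "(A - A') ** B = A ** B - A' ** (B :: complex^'n^'k)"
  and matrix_mult_add_right: "(A + A') ** B = A ** B + A' ** (B :: complex^'n^'k)"
  by (simp_all add: matrix_matrix_mult_def vec_eq_iff sum_subtractf sum.distrib algebra_simps)

section \<open>Frobenius norm and operator bounds\<close>

lemma norm_matrix_columns:
  fixes A :: "complex^'n^'m"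
  shows "(norm A)\<^sup>2 = (\<Sum>j\<in>UNIV. (norm (column j A))\<^sup>2)"
proof -
  have "(norm A)\<^sup>2 = (\<Sum>i\<in>UNIV. \<Sum>j\<in>UNIV. (cmod (A $ i $ j))\<^sup>2)"
    by (simp add: norm_vec_def L2_set_def sum_nonneg)
  also have "\<dots> = (\<Sum>j\<in>UNIV. \<Sum>i\<in>UNIV. (cmod (A $ i $ j))\<^sup>2)"
    by (rule sum.swap)
  also have "\<dots> = (\<Sum>j\<in>UNIV. (norm (column j A))\<^sup>2)"
    by (simp add: norm_vec_def L2_set_def sum_nonneg column_def)
  finally show ?thesis .
qed

lemma norm_adjoint_mat: "norm (adjoint_mat A) = norm A"
proof -
  have "(norm (adjoint_mat A))\<^sup>2 = (\<Sum>j\<in>UNIV. (norm (column j (adjoint_mat A)))\<^sup>2)"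
    by (rule norm_matrix_columns)
  also have "\<dots> = (norm A)\<^sup>2"
    by (simp add: norm_vec_def L2_set_def sum_nonneg column_def adjoint_mat_def)
  finally show ?thesis by simp
qed

text \<open>A matrix product acts column by column, so an operator bound on the left factor carries
  over to the Frobenius norm, which is the \<open>norm\<close> of the matrix type. This mixed
  estimate drives the contraction below.\<close>

lemma norm_matrix_mult_left_le:
  fixes A :: "complex^'k^'m" and B :: "complex^'n^'k"
  assumes "\<And>x. norm (A *v x) \<le> r * norm x" and "0 \<le> r"
  shows "norm (A ** B) \<le> r * norm B"
proof -
  have col: "column j (A ** B) = A *v column j B" for j
    by (simp add: column_def matrix_matrix_mult_def matrix_vector_mult_def vec_eq_iff)
  have "(norm (A ** B))\<^sup>2 \<le> (\<Sum>j\<in>UNIV. (r * norm (column j B))\<^sup>2)"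
    unfolding norm_matrix_columns col by (intro sum_mono power_mono assms) simp
  also have "\<dots> = (r * norm B)\<^sup>2"
    by (simp add: power_mult_distrib norm_matrix_columns sum_distrib_left)
  finally show ?thesis
    by (rule power2_le_imp_le) (simp add: assms)
qed

lemma matrix_norm_pos_bounded:
  fixes A :: "complex^'n^'m"
  obtains M where "1 \<le> M" and "\<And>x. norm (A *v x) \<le> M * norm x"
proof -
  obtain M where M: "\<And>x. norm (A *v x) \<le> norm x * M"
    using bounded_linear.bounded[OF matrix_vector_mul_bounded_linear[of A]] by blast
  have "norm (A *v x) \<le> max 1 M * norm x" for x
    using M[of x] mult_left_mono[of M "max 1 M" "norm x"] by (simp add: mult.commute)
  then show thesis
    using that[of "max 1 M"] by simp
qed

lemma closed_hermitian_bounded: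
  "closed {Y :: complex^'n^'n. hermitian Y \<and> (\<forall>x. norm (Y *v x) \<le> r * norm x)}"
proof -
  have adj: "continuous_on UNIV (adjoint_mat :: complex^'n^'n \<Rightarrow> _)"
    unfolding adjoint_mat_def by (intro continuous_intros)
  have mv: "continuous_on UNIV (\<lambda>Y :: complex^'n^'n. Y *v x)" for x
    unfolding matrix_vector_mult_def by (intro continuous_intros)
  show ?thesis
    unfolding hermitian_def
    by (intro closed_Collect_conj closed_Collect_all closed_Collect_eq closed_Collect_le
        continuous_on_norm adj mv continuous_intros)
qed

text \<open>
  The square root is \<open>M *\<^sub>R (mat 1 - Y)\<close>, where \<open>Y\<close> is the fixed point of
  \<open>Y \<mapsto> (E + Y\<^sup>2) / 2\<close> with \<open>E = mat 1 - P / M\<^sup>2\<close>. The map contracts Hermitian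
  matrices of operator norm at most \<open>r < 1\<close> in the Frobenius norm.
\<close>

lemma pos_sqrt_exists:
  fixes P :: "complex^'n^'n"
  assumes herm: "hermitian P" and ge1: "\<And>x. (norm x)\<^sup>2 \<le> (P *v x) \<bullet> x"
  obtains Q where "pos_mat Q" and "Q ** Q = P"
proof -
  obtain M where M: "1 \<le> M" and PM: "\<And>x. norm (P *v x) \<le> M * norm x"
    using matrix_norm_pos_bounded by blast
  \<comment> \<open>Expanding the square of |E x| and using <P x, x> >= |x|^2 and |P x| <= M |x|
    leaves the factor 1 - 2/M^2 + 1/M^2. The bound \<open>1 \<le> M\<close> makes the radicand
    nonnegative.\<close>
  define r where "r = sqrt (1 - 1 / M\<^sup>2)"
  have M2: "1 \<le> M\<^sup>2" using M by (simp add: one_le_power)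
  have r0: "0 \<le> r" and r1: "r < 1" and r2: "r\<^sup>2 = 1 - 1 / M\<^sup>2"
    using M2 M by (auto simp add: r_def)
  define E where "E = mat 1 - (1 / M\<^sup>2) *\<^sub>R P"
  have Ex: "norm (E *v x) \<le> r * norm x" for x
  proof -
    have norm_diff_square: "(norm (a - b))\<^sup>2 = (norm a)\<^sup>2 - 2 * (a \<bullet> b) + (norm b)\<^sup>2" for a b :: "complex^'n"
      unfolding power2_norm_eq_inner by (simp add: inner_diff_left inner_diff_right inner_commute)
    have "(norm (E *v x))\<^sup>2 = (norm x)\<^sup>2 - 2 / M\<^sup>2 * ((P *v x) \<bullet> x) + (norm (P *v x))\<^sup>2 / (M\<^sup>2)\<^sup>2"
      unfolding E_def matrix_vector_mult_diff_rdistrib matrix_vector_mult_scaleR_left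
      by (simp add: norm_diff_square inner_commute power_divide)
    also have "\<dots> \<le> (norm x)\<^sup>2 - 2 / M\<^sup>2 * (norm x)\<^sup>2 + (M * norm x)\<^sup>2 / (M\<^sup>2)\<^sup>2"
      using M by (intro add_mono diff_mono mult_left_mono divide_right_mono power_mono PM ge1) auto
    also have "\<dots> = (r * norm x)\<^sup>2"
      unfolding power_mult_distrib r2 using M by (simp add: field_simps power2_eq_square)
    finally show ?thesis
      by (rule power2_le_imp_le) (simp add: r0)
  qed
  define T where "T = {Y :: complex^'n^'n. hermitian Y \<and> (\<forall>x. norm (Y *v x) \<le> r * norm x)}"
  define f where "f Y = (1/2) *\<^sub>R (E + Y ** Y)" for Y
  have "\<exists>!Y. Y \<in> T \<and> f Y = Y"
  proof (rule Banach_fix)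
    show "complete T"
      unfolding T_def by (simp add: complete_eq_closed closed_hermitian_bounded)
    show "T \<noteq> {}"
      using r0 by (auto simp add: T_def hermitian_def adjoint_mat_def vec_eq_iff intro!: exI[of _ 0])
    show "f ` T \<subseteq> T"
    proof (intro image_subsetI)
      fix Y assume Y: "Y \<in> T"
      have "norm (f Y *v x) \<le> r * norm x" for x
      proof -
        \<comment> \<open>Since r < 1, the bound r^2 for the square of \<open>Y\<close> is at most
          r; averaged with the bound r for \<open>E\<close> it gives r again, so \<open>f\<close>
          keeps \<open>T\<close> invariant.\<close>
        have "norm (Y *v (Y *v x)) \<le> r * (r * norm x)"
          using Y r0 unfolding T_def by (blast intro: order_trans mult_left_mono)
        also have "\<dots> \<le> 1 * (r * norm x)"
          using r0 r1 by (intro mult_right_mono) auto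
        finally have "norm (E *v x + Y *v (Y *v x)) \<le> 2 * (r * norm x)"
          using Ex[of x] norm_triangle_ineq[of "E *v x" "Y *v (Y *v x)"] by simp
        then show ?thesis
          by (simp add: f_def matrix_vector_mult_scaleR_left matrix_vector_mult_add_rdistrib
              matrix_vector_mul_assoc)
      qed
      moreover have "hermitian (f Y)"
        using Y herm by (simp add: T_def hermitian_def f_def E_def adjoint_mat_scaleR adjoint_mat_add
            adjoint_mat_diff adjoint_mat_mult)
      ultimately show "f Y \<in> T" by (simp add: T_def)
    qed
    show "dist (f X) (f Y) \<le> r * dist X Y" if "X \<in> T" "Y \<in> T" for X Y
    proof -
      have XY: "adjoint_mat X = X" "adjoint_mat Y = Y" and bd: "\<And>x. norm (X *v x) \<le> r * norm x"
        "\<And>x. norm (Y *v x) \<le> r * norm x"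
        using that by (auto simp add: T_def hermitian_def)
      \<comment> \<open>X^2 - Y^2 splits as X (X - Y) + (X - Y) Y. In the second term the bounded
        factor stands on the right; taking adjoints, which preserve the Frobenius norm, moves it to
        the left.\<close>
      have "adjoint_mat ((X - Y) ** Y) = Y ** (X - Y)"
        by (simp add: adjoint_mat_mult adjoint_mat_diff XY)
      then have "norm ((X - Y) ** Y) = norm (Y ** (X - Y))"
        by (metis norm_adjoint_mat)
      then have le: "norm (X ** (X - Y)) \<le> r * norm (X - Y)" "norm ((X - Y) ** Y) \<le> r * norm (X - Y)"
        using norm_matrix_mult_left_le[OF _ r0] bd by metis+
      have "f X - f Y = (1/2) *\<^sub>R (X ** (X - Y) + (X - Y) ** Y)"
        unfolding f_def by (simp add: matrix_mult_diff_left matrix_mult_diff_right scaleR_right_diff_distrib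
            scaleR_right_distrib)
      then have "norm (f X - f Y) = norm (X ** (X - Y) + (X - Y) ** Y) / 2"
        by simp
      then show ?thesis
        using le norm_triangle_ineq[of "X ** (X - Y)" "(X - Y) ** Y"] by (simp add: dist_norm)
    qed
  qed (use r0 r1 in auto)
  then obtain Y where Y: "Y \<in> T" and fY: "f Y = Y" by blast
  define Q where "Q = M *\<^sub>R (mat 1 - Y)"
  \<comment> \<open>The fixed point equation reads 2 Y = E + Y^2, which is (1 - Y)^2 = 1 -
    E.\<close>
  have "Y + Y = 2 *\<^sub>R f Y" by (simp add: fY scaleR_2)
  then have E: "E = Y + (Y - Y ** Y)"
    by (simp add: f_def)
  have "(mat 1 - Y) ** (mat 1 - Y) = mat 1 - E"
    unfolding E by (simp add: matrix_mult_diff_left matrix_mult_diff_right del: mult_2)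
  then have "Q ** Q = M\<^sup>2 *\<^sub>R (mat 1 - E)"
    by (simp add: Q_def matrix_mult_scaleR_left matrix_mult_scaleR_right power2_eq_square)
  also have "\<dots> = P" using M by (simp add: E_def)
  finally have "Q ** Q = P" .
  moreover have "hermitian Q"
    using Y by (simp add: Q_def T_def hermitian_def adjoint_mat_scaleR adjoint_mat_diff)
  moreover have "0 < (Q *v x) \<bullet> x" if "x \<noteq> 0" for x
  proof -
    have "(Y *v x) \<bullet> x \<le> norm (Y *v x) * norm x" by (rule norm_cauchy_schwarz)
    also have "\<dots> \<le> r * norm x * norm x"
      using Y by (intro mult_right_mono) (auto simp add: T_def)
    also have "\<dots> < 1 * norm x * norm x"
      using that r1 by (intro mult_strict_right_mono) auto
    also have "\<dots> = x \<bullet> x" by (simp add: dot_square_norm power2_eq_square)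
    finally have "(Y *v x) \<bullet> x < x \<bullet> x" .
    then show ?thesis
      using M by (simp add: Q_def matrix_vector_mult_scaleR_left matrix_vector_mult_diff_rdistrib
          inner_diff_left)
  qed
  ultimately show thesis
    by (intro that[of Q]) (auto simp add: pos_mat_def Re_cinner)
qed

text \<open>
  With \<open>S = Q + Q'\<close> and \<open>D = Q - Q'\<close> one has \<open>S D + D S = 0\<close>, so the trace
  of the nonnegative matrix \<open>D S D\<close> vanishes.
\<close>

lemma nonneg_sqrt_unique:
  fixes Q Q' :: "complex^'n^'n"
  assumes Q: "nonneg_mat Q" and Q': "pos_mat Q'" and eq: "Q ** Q = Q' ** Q'"
  shows "Q = Q'"
proof -
  define S where "S = Q + Q'"
  define D where "D = Q - Q'"
  have D: "adjoint_mat D = D"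
    using Q Q' by (simp add: D_def nonneg_mat_def pos_mat_def hermitian_def adjoint_mat_diff)
  have Spos: "0 < (S *v x) \<bullet> x" if "x \<noteq> 0" for x
    using Q Q' that by (auto simp add: S_def nonneg_mat_def pos_mat_def Re_cinner
        matrix_vector_mult_add_rdistrib inner_add_left intro!: add_nonneg_pos)
  have "S ** D + D ** S = 0"
    using eq by (simp add: S_def D_def matrix_mult_diff_left matrix_mult_diff_right
        matrix_add_ldistrib matrix_mult_add_right)
  then have "trace (D ** (S ** D + D ** S)) = 0"
    by (simp add: trace_def matrix_matrix_mult_def)
  \<comment> \<open>By cyclicity both halves of the vanishing trace coincide with the trace of D S
    D.\<close>
  moreover have "trace (D ** (D ** S)) = trace (D ** (S ** D))"
    by (metis trace_mul_sym matrix_mul_assoc)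
  ultimately have tr: "trace (D ** S ** D) = 0"
    by (simp add: matrix_add_ldistrib trace_add matrix_mul_assoc)
  \<comment> \<open>Each diagonal entry is the quadratic form of \<open>S\<close> at a column of
    \<open>D\<close>. These are nonnegative numbers with sum zero, so definiteness of
    \<open>S\<close> kills every column.\<close>
  have diag: "(D ** S ** D) $ i $ i = cinner (S *v column i D) (column i D)" for i
  proof -
    have "(D ** S ** D) $ i $ i = cinner ((D ** S ** D) *v axis i 1) (axis i 1)"
      by (simp add: cinner_axis matrix_vector_mult_axis column_def)
    also have "\<dots> = cinner (S *v (D *v axis i 1)) (D *v axis i 1)"
      by (simp add: matrix_vector_mul_assoc [symmetric] cinner_matrix_left D)
    finally show ?thesis by (simp add: matrix_vector_mult_axis)
  qed
  have "(\<Sum>i\<in>UNIV. (S *v column i D) \<bullet> column i D) = Re (trace (D ** S ** D))"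
    by (simp add: trace_def diag Re_cinner)
  then have "(\<Sum>i\<in>UNIV. (S *v column i D) \<bullet> column i D) = 0" by (simp add: tr)
  moreover have "0 \<le> (S *v x) \<bullet> x" for x
    using Spos[of x] by (cases "x = 0") auto
  ultimately have "\<forall>i. (S *v column i D) \<bullet> column i D = 0"
    by (simp add: sum_nonneg_eq_0_iff)
  then have "column i D = 0" for i
    using Spos[of "column i D"] by force
  then have "D = 0" by (simp add: column_def vec_eq_iff)
  then show ?thesis by (simp add: D_def)
qed

text \<open>The competitors in the definite description are only nonnegative, while the constructed
  root is positive definite; the uniqueness result is asymmetric to match this.\<close>

lemma sqrt_mat_ge_one:
  fixes P :: "complex^'n^'n"
  assumes "hermitian P" and "\<And>x. (norm x)\<^sup>2 \<le> (P *v x) \<bullet> x"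
  shows "pos_mat (sqrt_mat P)" and "sqrt_mat P ** sqrt_mat P = P"
proof -
  obtain Q where Q: "pos_mat Q" "Q ** Q = P"
    using pos_sqrt_exists assms by blast
  have "nonneg_mat Q"
    unfolding nonneg_mat_def
  proof (intro conjI allI)
    show "hermitian Q" using Q by (simp add: pos_mat_def)
    show "0 \<le> Re (cinner (Q *v x) x)" for x
      using Q by (cases "x = 0") (auto simp add: pos_mat_def Re_cinner less_imp_le)
  qed
  then have "sqrt_mat P = Q"
    unfolding sqrt_mat_def using Q nonneg_sqrt_unique by (intro the_equality) auto
  with Q show "pos_mat (sqrt_mat P)" "sqrt_mat P ** sqrt_mat P = P" by auto
qed

lemma pos_mat_invertible:
  assumes "pos_mat Q"
  shows "invertible Q"
proof -
  have "x = 0" if "Q *v x = 0" for x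
    using assms that by (auto simp add: pos_mat_def Re_cinner)
  then show ?thesis
    by (simp add: invertible_left_inverse matrix_left_invertible_ker)
qed

section \<open>Primitives of integrable functions\<close>

lemma finite_measure_unit_interval: "finite_measure (lebesgue_on {0..1::real})"
  using finite_measure_lebesgue_on[OF lmeasurable_cbox[of 0 "1::real"]] by simp

interpretation unit_interval: finite_measure "lebesgue_on {0..1::real}"
  by (rule finite_measure_unit_interval)

interpretation unit_square: pair_sigma_finite "lebesgue_on {0..1::real}" "lebesgue_on {0..1::real}" ..

lemma AE_unit_interval_neq: "AE t in lebesgue_on {0..1::real}. t \<noteq> x"
proof -
  have "AE t in lebesgue. t \<noteq> x"
    by (rule AE_completion[OF AE_lborel_singleton])
  then have "AE t in lebesgue. t \<in> {0..1} \<longrightarrow> t \<noteq> x" by (rule eventually_mono) simp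
  then show ?thesis by (subst AE_restrict_space_iff) simp_all
qed

lemma borel_measurable_id_unit [measurable]: "(\<lambda>x. x) \<in> borel_measurable (lebesgue_on {0..1::real})"
  by (rule measurable_restrict_space1) (simp add: measurable_completion)

text \<open>Translates truncated Lebesgue integrals into Henstock-Kurzweil integrals over
  \<open>{0..x}\<close>. Both the weak and the strict cut-off occur because the diagonal of the unit
  square has to be given to exactly one of two triangles.\<close>

lemma integral_unit_interval_le:
  fixes k :: "real \<Rightarrow> 'a::euclidean_space"
  assumes k: "integrable (lebesgue_on {0..1}) k" and x: "x \<in> {0..1}"
  shows "(LINT t|lebesgue_on {0..1}. (if t \<le> x then k t else 0)) = integral {0..x} k"
    and "(LINT t|lebesgue_on {0..1}. (if t < x then k t else 0)) = integral {0..x} k"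
proof -
  note [measurable] = borel_measurable_integrable[OF k]
  have "integrable (lebesgue_on {0..1}) (\<lambda>t. if t \<le> x then k t else 0)"
    by (rule Bochner_Integration.integrable_bound[OF k]) auto
  then have "(LINT t|lebesgue_on {0..1}. (if t \<le> x then k t else 0)) =
      integral {0..1} (\<lambda>t. if t \<le> x then k t else 0)"
    by (rule lebesgue_integral_eq_integral) simp
  also have "\<dots> = integral {0..1} (\<lambda>t. if t \<in> {0..x} then k t else 0)"
    by (intro Henstock_Kurzweil_Integration.integral_cong) auto
  also have "\<dots> = integral {0..x} k"
    using x by (subst integral_restrict_Int) (simp add: Int_absorb2)
  finally show 1: "(LINT t|lebesgue_on {0..1}. (if t \<le> x then k t else 0)) = integral {0..x} k" .
  have "(LINT t|lebesgue_on {0..1}. (if t < x then k t else 0)) =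
      (LINT t|lebesgue_on {0..1}. (if t \<le> x then k t else 0))"
  proof (rule integral_cong_AE)
    show "AE t in lebesgue_on {0..1}. (if t < x then k t else 0) = (if t \<le> x then k t else 0)"
      using AE_unit_interval_neq[of x] by (rule eventually_mono) simp
  qed measurable
  with 1 show "(LINT t|lebesgue_on {0..1}. (if t < x then k t else 0)) = integral {0..x} k" by simp
qed

lemma integral_unit_interval_integral:
  fixes k :: "real \<Rightarrow> 'a::euclidean_space"
  assumes "integrable (lebesgue_on {0..1}) k"
  shows "(LINT t|lebesgue_on {0..1}. k t) = integral {0..1} k"
  using assms by (rule lebesgue_integral_eq_integral) simp

lemma continuous_on_indefinite_integral:
  fixes k H :: "real \<Rightarrow> 'a::euclidean_space"
  assumes k: "integrable (lebesgue_on {0..1}) k"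
    and H: "\<And>x. x \<in> {0..1} \<Longrightarrow> H x = H 0 + integral {0..x} k"
  shows "continuous_on {0..1} H"
proof -
  have "continuous_on {0..1} (\<lambda>x. H 0 + integral {0..x} k)"
    by (intro continuous_intros indefinite_integral_continuous_1 integrable_on_lebesgue_on[OF k]) simp_all
  then show ?thesis by (rule continuous_on_eq) (rule H[symmetric])
qed

lemma borel_measurable_bilinear:
  fixes prod :: "'a::euclidean_space \<Rightarrow> 'b::euclidean_space \<Rightarrow> 'c::euclidean_space"
  assumes "bounded_bilinear prod" and "f \<in> borel_measurable M" and "g \<in> borel_measurable M"
  shows "(\<lambda>x. prod (f x) (g x)) \<in> borel_measurable M"
  using assms(2,3) by (rule borel_measurable_continuous_Pair)
    (intro bounded_bilinear.continuous_on[OF assms(1)] continuous_intros)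

lemma integrable_bilinear_bounded:
  fixes prod :: "'a::euclidean_space \<Rightarrow> 'b::euclidean_space \<Rightarrow> 'c::euclidean_space"
    and h :: "real \<Rightarrow> 'a" and K :: "real \<Rightarrow> 'b"
  assumes prod: "bounded_bilinear prod"
    and h: "integrable (lebesgue_on {0..1}) h" and K: "continuous_on {0..1} K"
  shows "integrable (lebesgue_on {0..1}) (\<lambda>x. prod (h x) (K x))"
proof -
  have [measurable]: "K \<in> borel_measurable (lebesgue_on {0..1})"
    using K by (rule continuous_imp_measurable_on_sets_lebesgue) simp
  note [measurable] = borel_measurable_integrable[OF h]
  obtain b where b: "\<And>x. x \<in> {0..1} \<Longrightarrow> norm (K x) \<le> b"
    using compact_imp_bounded[OF compact_continuous_image[OF K]] unfolding bounded_iff by blast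
  obtain c where c: "0 \<le> c" "\<And>x y. norm (prod x y) \<le> norm x * norm y * c"
    using bounded_bilinear.nonneg_bounded[OF prod] by blast
  show ?thesis
  proof (rule Bochner_Integration.integrable_bound)
    show "integrable (lebesgue_on {0..1}) (\<lambda>x. norm (h x) * (b * c))"
      using h by simp
    show "AE x in lebesgue_on {0..1}. norm (prod (h x) (K x)) \<le> norm (norm (h x) * (b * c))"
    proof (rule AE_I2)
      fix x :: real assume "x \<in> space (lebesgue_on {0..1})"
      then have "norm (h x) * norm (K x) * c \<le> norm (h x) * b * c"
        using b c(1) by (intro mult_right_mono mult_left_mono) auto
      with c(2)[of "h x" "K x"] show "norm (prod (h x) (K x)) \<le> norm (norm (h x) * (b * c))"
        by (simp add: mult.assoc)
    qed
  qed (intro borel_measurable_bilinear[OF prod]; measurable)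
qed

text \<open>Fubini's theorem for (x, t) \<mapsto> \<open>prod (h x) (k t)\<close> on the unit
  square, cut along the diagonal: on the triangle t <= x the inner integral over t yields the
  primitive of \<open>k\<close>, and on x < t the inner integral over x yields that of
  \<open>h\<close>.\<close>

lemma integration_by_parts_primitive_zero:
  fixes prod :: "'a::euclidean_space \<Rightarrow> 'b::euclidean_space \<Rightarrow> 'c::euclidean_space"
    and h :: "real \<Rightarrow> 'a" and k :: "real \<Rightarrow> 'b"
  assumes prod: "bounded_bilinear prod"
    and h: "integrable (lebesgue_on {0..1}) h" and k: "integrable (lebesgue_on {0..1}) k"
  shows "(LINT x|lebesgue_on {0..1}. prod (h x) (integral {0..x} k)) +
      (LINT x|lebesgue_on {0..1}. prod (integral {0..x} h) (k x)) =
      prod (integral {0..1} h) (integral {0..1} k)" (is "?I1 + ?I2 = _")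
proof -
  let ?M = "lebesgue_on {0..1::real}"
  interpret prod: bounded_bilinear prod by (rule prod)
  note [measurable] = borel_measurable_integrable[OF h] borel_measurable_integrable[OF k]
  obtain c where c: "0 \<le> c" "\<And>x y. norm (prod x y) \<le> norm x * norm y * c"
    using prod.nonneg_bounded by blast
  have F: "integrable (?M \<Otimes>\<^sub>M ?M) (\<lambda>(x, t). prod (h x) (k t))"
  proof (rule Bochner_Integration.integrable_bound)
    show "integrable (?M \<Otimes>\<^sub>M ?M) (\<lambda>p. norm (h (fst p)) * norm (k (snd p)) * c)"
      using c(1) h k by (intro unit_square.Fubini_integrable) (simp_all add: abs_mult)
    show "AE p in ?M \<Otimes>\<^sub>M ?M. norm (case p of (x, t) \<Rightarrow> prod (h x) (k t))
        \<le> norm (norm (h (fst p)) * norm (k (snd p)) * c)"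
      using c by (intro AE_I2) (auto simp add: split_beta)
    show "(\<lambda>(x, t). prod (h x) (k t)) \<in> borel_measurable (?M \<Otimes>\<^sub>M ?M)"
      unfolding split_beta by (intro borel_measurable_bilinear[OF prod]; measurable)
  qed
  note [measurable] = borel_measurable_integrable[OF F]
  define F1 where "F1 = (\<lambda>x t. if t \<le> x then prod (h x) (k t) else 0)"
  define F2 where "F2 = (\<lambda>x t. if x < t then prod (h x) (k t) else 0)"
  have [measurable]: "Measurable.pred (?M \<Otimes>\<^sub>M ?M) (\<lambda>p. snd p \<le> fst p)"
      "Measurable.pred (?M \<Otimes>\<^sub>M ?M) (\<lambda>p. fst p < snd p)"
    by measurable
  have F1: "integrable (?M \<Otimes>\<^sub>M ?M) (case_prod F1)"
    using F by (rule Bochner_Integration.integrable_bound) (auto simp add: F1_def split_beta)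
  have F2: "integrable (?M \<Otimes>\<^sub>M ?M) (case_prod F2)"
    using F by (rule Bochner_Integration.integrable_bound) (auto simp add: F2_def split_beta)
  have I1: "?I1 = (LINT x|?M. LINT t|?M. F1 x t)"
  proof (rule Bochner_Integration.integral_cong)
    fix x assume "x \<in> space ?M"
    moreover have "integrable ?M (\<lambda>t. if t \<le> x then k t else 0)"
      by (rule Bochner_Integration.integrable_bound[OF k]) auto
    then have "(LINT t|?M. prod (h x) (if t \<le> x then k t else 0)) =
        prod (h x) (LINT t|?M. (if t \<le> x then k t else 0))"
      by (rule integral_bounded_linear[OF prod.bounded_linear_right])
    ultimately show "prod (h x) (integral {0..x} k) = (LINT t|?M. F1 x t)"
      by (simp add: F1_def if_distrib prod.zero_right integral_unit_interval_le(1)[OF k] cong: if_cong)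
  qed simp
  have I2: "?I2 = (LINT t|?M. LINT x|?M. F2 x t)"
  proof (rule Bochner_Integration.integral_cong)
    fix t assume "t \<in> space ?M"
    moreover have "integrable ?M (\<lambda>x. if x < t then h x else 0)"
      by (rule Bochner_Integration.integrable_bound[OF h]) auto
    then have "(LINT x|?M. prod (if x < t then h x else 0) (k t)) =
        prod (LINT x|?M. (if x < t then h x else 0)) (k t)"
      by (rule integral_bounded_linear[OF prod.bounded_linear_left])
    ultimately show "prod (integral {0..t} h) (k t) = (LINT x|?M. F2 x t)"
      by (simp add: F2_def if_distrib[of "\<lambda>y. prod y (k t)"] prod.zero_left
          integral_unit_interval_le(2)[OF h] cong: if_cong)
  qed simp
  have "?I1 + ?I2 = (LINT p|(?M \<Otimes>\<^sub>M ?M). case_prod F1 p + case_prod F2 p)"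
    unfolding I1 I2 unit_square.integral_fst[OF F1] unit_square.integral_snd[OF F2]
    by (rule Bochner_Integration.integral_add[OF F1 F2, symmetric])
  also have "(\<lambda>p. case_prod F1 p + case_prod F2 p) = (\<lambda>(x, t). prod (h x) (k t))"
    by (auto simp add: F1_def F2_def fun_eq_iff)
  also have "integral\<^sup>L (?M \<Otimes>\<^sub>M ?M) (\<lambda>(x, t). prod (h x) (k t)) = (LINT x|?M. LINT t|?M. prod (h x) (k t))"
    by (rule unit_square.integral_fst[OF F, symmetric])
  also have "\<dots> = prod (integral {0..1} h) (integral {0..1} k)"
    by (simp add: integral_bounded_linear[OF prod.bounded_linear_right k]
        integral_bounded_linear[OF prod.bounded_linear_left h]
        integral_unit_interval_integral[OF h] integral_unit_interval_integral[OF k])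
  finally show ?thesis .
qed

text \<open>The initial values split off by bilinearity. A general \<open>prod\<close> serves two
  purposes: scalar multiplication for pairing with test functions, and the quadratic form of \<Pi>
  in the Riccati equation.\<close>

lemma integration_by_parts_primitive:
  fixes prod :: "'a::euclidean_space \<Rightarrow> 'b::euclidean_space \<Rightarrow> 'c::euclidean_space"
    and h :: "real \<Rightarrow> 'a" and k :: "real \<Rightarrow> 'b"
  assumes prod: "bounded_bilinear prod"
    and h: "integrable (lebesgue_on {0..1}) h" and k: "integrable (lebesgue_on {0..1}) k"
    and H: "\<And>x. x \<in> {0..1} \<Longrightarrow> H x = H 0 + integral {0..x} h"
    and K: "\<And>x. x \<in> {0..1} \<Longrightarrow> K x = K 0 + integral {0..x} k"
  shows "(LINT x|lebesgue_on {0..1}. prod (h x) (K x)) +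
      (LINT x|lebesgue_on {0..1}. prod (H x) (k x)) = prod (H 1) (K 1) - prod (H 0) (K 0)"
proof -
  let ?M = "lebesgue_on {0..1::real}"
  interpret prod: bounded_bilinear prod by (rule prod)
  have cont: "continuous_on {0..1} (\<lambda>x. integral {0..x} h)" "continuous_on {0..1} (\<lambda>x. integral {0..x} k)"
    by (rule continuous_on_indefinite_integral[OF h] continuous_on_indefinite_integral[OF k]; simp)+
  have "(LINT x|?M. prod (h x) (K x)) = (LINT x|?M. prod (h x) (K 0) + prod (h x) (integral {0..x} k))"
    by (intro Bochner_Integration.integral_cong refl) (subst K, simp_all add: prod.add_right)
  also have "\<dots> = prod (integral {0..1} h) (K 0) + (LINT x|?M. prod (h x) (integral {0..x} k))"
    by (simp add: integrable_bilinear_bounded[OF prod h] cont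
        integral_bounded_linear[OF prod.bounded_linear_left h] integral_unit_interval_integral[OF h])
  finally have 1: "(LINT x|?M. prod (h x) (K x)) = \<dots>" .
  have "(LINT x|?M. prod (H x) (k x)) = (LINT x|?M. prod (H 0) (k x) + prod (integral {0..x} h) (k x))"
    by (intro Bochner_Integration.integral_cong refl) (subst H, simp_all add: prod.add_left)
  also have "\<dots> = prod (H 0) (integral {0..1} k) + (LINT x|?M. prod (integral {0..x} h) (k x))"
    by (simp add: integrable_bilinear_bounded[OF bounded_bilinear.flip[OF prod] k] cont
        integral_bounded_linear[OF prod.bounded_linear_right k] integral_unit_interval_integral[OF k])
  finally have 2: "(LINT x|?M. prod (H x) (k x)) = \<dots>" .
  have "prod (H 1) (K 1) = prod (H 0 + integral {0..1} h) (K 0 + integral {0..1} k)"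
    using H[of 1] K[of 1] by simp
  then show ?thesis
    unfolding 1 2 using integration_by_parts_primitive_zero[OF prod h k]
    by (simp add: prod.add_left prod.add_right algebra_simps)
qed

section \<open>Functions with a weak derivative\<close>

text \<open>The support clause of \<open>test_fun\<close>, isolated so that it also applies to
  functions that are merely continuous.\<close>

definition compactly_supported_01 :: "(real \<Rightarrow> 'a::zero) \<Rightarrow> bool" where
  "compactly_supported_01 \<psi> \<longleftrightarrow> (\<exists>a>0. \<exists>b<1. \<forall>x. x \<notin> {a..b} \<longrightarrow> \<psi> x = 0)"

text \<open>\<open>\<integral>\<bar>f\<bar>\<close> is a limit of integrals \<open>\<integral>\<psi> f\<close>, because \<open>sgn \<circ> f\<close> is an almost everywhere limit of
  continuous functions.\<close>

lemma AE_zero_if_orthogonal: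
  fixes f :: "real \<Rightarrow> real"
  assumes f: "integrable (lebesgue_on {0..1}) f"
    and orth: "\<And>\<psi>. continuous_on UNIV \<psi> \<Longrightarrow> compactly_supported_01 \<psi> \<Longrightarrow>
      (LINT x|lebesgue_on {0..1}. \<psi> x * f x) = 0"
  shows "AE x in lebesgue_on {0..1}. f x = 0"
proof -
  let ?M = "lebesgue_on {0..1::real}"
  note [measurable] = borel_measurable_integrable[OF f]
  have "(\<lambda>x. sgn (f x)) \<in> borel_measurable ?M" by measurable
  then have "(\<lambda>x. sgn (f x)) measurable_on {0..1}"
    by (simp add: measurable_on_iff_borel_measurable)
  \<comment> \<open>\<open>measurable_on\<close> means being a limit of continuous functions off a
    negligible set. These approximants may be unbounded and need not vanish near 0 and 1; both
    defects are repaired next.\<close>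
  then obtain N g where N: "negligible N" and g: "\<And>n :: nat. continuous_on UNIV (g n)"
    and lim: "\<And>x. x \<notin> N \<Longrightarrow> (\<lambda>n. g n x) \<longlonglongrightarrow> (if x \<in> {0..1} then sgn (f x) else 0)"
    unfolding measurable_on_def by blast
  \<comment> \<open>A trapezoid: 0 up to distance 1/(n+1) from the endpoints and 1 from distance
    2/(n+1) on. \<open>Suc n\<close> avoids a division by zero at n = 0.\<close>
  define cut where "cut n x = max 0 (min 1 (min (real (Suc n) * x - 1) (real (Suc n) * (1 - x) - 1)))"
    for n and x :: real
  \<comment> \<open>Clamping to [-1, 1] makes |f| a dominating function and does not disturb the
    limit, because \<open>sgn\<close> takes its values there.\<close>
  define \<psi> where "\<psi> n x = cut n x * max (- 1) (min 1 (g n x))" for n x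
  have cont: "continuous_on UNIV (\<psi> n)" for n
    unfolding \<psi>_def cut_def by (intro continuous_intros g)
  have supp: "compactly_supported_01 (\<psi> n)" for n
    unfolding compactly_supported_01_def
  proof (intro exI conjI allI impI)
    show "0 < 1 / real (Suc n)" "1 - 1 / real (Suc n) < 1" by simp_all
    fix x assume "x \<notin> {1 / real (Suc n)..1 - 1 / real (Suc n)}"
    then have "real (Suc n) * x - 1 \<le> 0 \<or> real (Suc n) * (1 - x) - 1 \<le> 0"
      by (auto simp add: field_simps simp del: of_nat_Suc)
    then show "\<psi> n x = 0" by (auto simp add: \<psi>_def cut_def)
  qed
  have bound: "\<bar>\<psi> n x\<bar> \<le> 1" for n x
  proof -
    have "\<bar>cut n x\<bar> * \<bar>max (- 1) (min 1 (g n x))\<bar> \<le> 1 * 1"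
      by (intro mult_mono) (auto simp add: cut_def)
    then show ?thesis by (simp add: \<psi>_def abs_mult)
  qed
  have conv: "(\<lambda>n. \<psi> n x) \<longlonglongrightarrow> sgn (f x)" if x: "x \<notin> N" "0 < x" "x < 1" for x
  proof -
    have "\<forall>\<^sub>F n in sequentially. 2 / x \<le> real (Suc n) \<and> 2 / (1 - x) \<le> real (Suc n)"
      by (intro eventually_conj; real_asymp)
    then have "\<forall>\<^sub>F n in sequentially. cut n x = 1"
      by eventually_elim (use x in \<open>simp add: cut_def field_simps del: of_nat_Suc\<close>)
    then have "(\<lambda>n. cut n x) \<longlonglongrightarrow> 1" by (rule tendsto_eventually)
    moreover have "(\<lambda>n. max (- 1) (min 1 (g n x))) \<longlonglongrightarrow> max (- 1) (min 1 (sgn (f x)))"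
      using lim[of x] x by (intro tendsto_intros) auto
    ultimately have "(\<lambda>n. \<psi> n x) \<longlonglongrightarrow> 1 * max (- 1) (min 1 (sgn (f x)))"
      unfolding \<psi>_def by (rule tendsto_mult)
    moreover have "max (- 1) (min 1 (sgn (f x))) = sgn (f x)" by (auto simp add: sgn_if)
    ultimately show ?thesis by simp
  qed
  have "AE x in lebesgue. x \<notin> N"
    using N by (intro AE_not_in) (simp add: negligible_iff_null_sets)
  then have "AE x in ?M. x \<notin> N"
    by (subst AE_restrict_space_iff) auto
  then have "AE x in ?M. x \<notin> N \<and> 0 < x \<and> x < 1"
    using AE_unit_interval_neq[of 0] AE_unit_interval_neq[of 1] AE_space[of ?M]
    by eventually_elim auto
  then have AE: "AE x in ?M. (\<lambda>n. \<psi> n x * f x) \<longlonglongrightarrow> \<bar>f x\<bar>"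
  proof eventually_elim
    case (elim x)
    then have "(\<lambda>n. \<psi> n x * f x) \<longlonglongrightarrow> sgn (f x) * f x"
      by (intro tendsto_mult conv tendsto_const) auto
    moreover have "sgn (f x) * f x = \<bar>f x\<bar>" by (simp add: sgn_if)
    ultimately show ?case by simp
  qed
  have [measurable]: "\<psi> n \<in> borel_measurable ?M" for n
    using cont[of n] by (intro continuous_imp_measurable_on_sets_lebesgue) (auto intro: continuous_on_subset)
  have "(\<lambda>n. LINT x|?M. \<psi> n x * f x) \<longlonglongrightarrow> (LINT x|?M. \<bar>f x\<bar>)"
  proof (rule integral_dominated_convergence)
    show "integrable ?M (\<lambda>x. \<bar>f x\<bar>)" using f by simp
    show "AE x in ?M. norm (\<psi> n x * f x) \<le> \<bar>f x\<bar>" for n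
      using bound[of n] by (intro AE_I2) (simp add: abs_mult mult_left_le_one_le)
    show "AE x in ?M. (\<lambda>n. \<psi> n x * f x) \<longlonglongrightarrow> \<bar>f x\<bar>" by (rule AE)
  qed measurable
  moreover have "(LINT x|?M. \<psi> n x * f x) = 0" for n
    by (rule orth[OF cont supp])
  ultimately have "(LINT x|?M. \<bar>f x\<bar>) = 0"
    by (simp add: LIMSEQ_const_iff)
  then have "AE x in ?M. \<bar>f x\<bar> = 0"
    using f by (subst (asm) integral_nonneg_eq_0_iff_AE) auto
  then show ?thesis by simp
qed

lemma continuous_integrable_unit:
  fixes \<psi> :: "real \<Rightarrow> 'a::euclidean_space"
  assumes "continuous_on {0..1} \<psi>"
  shows "integrable (lebesgue_on {0..1}) \<psi>"
  using integrable_bilinear_bounded[OF bounded_bilinear_scaleR _ assms, of "\<lambda>_. 1"] by simp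

text \<open>An antiderivative is constant on each side of the support. The zero mean makes the two
  constants equal, so subtracting the common value \<open>F 0\<close> gives compact support.\<close>

lemma compactly_supported_primitive_test_fun:
  assumes cont: "continuous_on UNIV \<psi>" and supp: "compactly_supported_01 \<psi>"
    and mean: "(LINT x|lebesgue_on {0..1}. \<psi> x) = 0"
  obtains \<phi> where "test_fun \<phi> \<psi>"
proof -
  obtain a b where ab: "0 < a" "b < 1" and zero: "\<And>x. x \<notin> {a..b} \<Longrightarrow> \<psi> x = 0"
    using supp unfolding compactly_supported_01_def by blast
  obtain F where F: "\<And>x. (F has_vector_derivative \<psi> x) (at x)"
    using einterval_antiderivative[of "-\<infinity>" "\<infinity>" \<psi>] cont
    by (auto simp add: continuous_on_eq_continuous_at)
  then have DF: "(F has_real_derivative \<psi> x) (at x)" for x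
    by (simp add: has_real_derivative_iff_has_vector_derivative)
  have "(\<psi> has_integral (F 1 - F 0)) {0..1}"
    by (intro fundamental_theorem_of_calculus) (auto intro: F has_vector_derivative_at_within)
  moreover have "integral {0..1} \<psi> = 0"
    using mean integral_unit_interval_integral[OF continuous_integrable_unit] cont
    by (metis continuous_on_subset subset_UNIV)
  ultimately have F01: "F 1 = F 0"
    by (simp add: integral_unique)
  have left: "F x = F 0" if "x < a" for x
  proof -
    have "(F has_real_derivative 0) (at x within {..<a})" if "x \<in> {..<a}" for x
      using has_field_derivative_at_within[OF DF[of x]] zero[of x] that by simp
    then have "\<exists>c. \<forall>x\<in>{..<a}. F x = c"
      by (intro has_field_derivative_zero_constant) auto
    with that ab(1) show ?thesis by (metis lessThan_iff)
  qed
  have right: "F x = F 0" if "b < x" for x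
  proof -
    have "(F has_real_derivative 0) (at x within {b<..})" if "x \<in> {b<..}" for x
      using has_field_derivative_at_within[OF DF[of x]] zero[of x] that by simp
    then have "\<exists>c. \<forall>x\<in>{b<..}. F x = c"
      by (intro has_field_derivative_zero_constant) auto
    with that ab(2) show ?thesis by (metis F01 greaterThan_iff)
  qed
  have "test_fun (\<lambda>x. F x - F 0) \<psi>"
    unfolding test_fun_def
  proof (intro conjI allI)
    show "((\<lambda>x. F x - F 0) has_real_derivative \<psi> x) (at x)" for x
      by (auto intro!: derivative_eq_intros DF)
    show "\<exists>a>0. \<exists>b<1. \<forall>x. x \<notin> {a..b} \<longrightarrow> F x - F 0 = 0"
    proof -
      have "\<forall>x. x \<notin> {a..b} \<longrightarrow> F x - F 0 = 0"
        using left right by (auto simp add: not_le)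
      with ab show ?thesis by blast
    qed
  qed (rule cont)
  then show thesis by (rule that)
qed

lemma compactly_supported_01_diff:
  fixes \<psi> \<eta> :: "real \<Rightarrow> real"
  assumes "compactly_supported_01 \<psi>" and "compactly_supported_01 \<eta>"
  shows "compactly_supported_01 (\<lambda>x. \<psi> x - c * \<eta> x)"
proof -
  obtain a b a' b' where "0 < a" "b < 1" "0 < a'" "b' < 1"
    "\<And>x. x \<notin> {a..b} \<Longrightarrow> \<psi> x = 0" "\<And>x. x \<notin> {a'..b'} \<Longrightarrow> \<eta> x = 0"
    using assms unfolding compactly_supported_01_def by blast
  moreover from this have "\<psi> x - c * \<eta> x = 0" if "x \<notin> {min a a'..max b b'}" for x
  proof -
    have "x \<notin> {a..b}" "x \<notin> {a'..b'}" using that by auto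
    then show ?thesis using calculation(5,6) by simp
  qed
  ultimately have "0 < min a a'" "max b b' < 1"
    "\<forall>x. x \<notin> {min a a'..max b b'} \<longrightarrow> \<psi> x - c * \<eta> x = 0"
    by auto
  then show ?thesis unfolding compactly_supported_01_def by blast
qed

text \<open>
  The lemma of du Bois-Reymond: subtracting a multiple of a fixed \<open>\<eta>\<close> with nonzero mean turns
  \<open>\<psi>\<close> into the derivative of a test function.
\<close>

lemma AE_const_if_orthogonal_derivatives:
  fixes f :: "real \<Rightarrow> real"
  assumes f: "integrable (lebesgue_on {0..1}) f"
    and orth: "\<And>\<phi> \<phi>'. test_fun \<phi> \<phi>' \<Longrightarrow> (LINT x|lebesgue_on {0..1}. \<phi>' x * f x) = 0"
  shows "\<exists>c. AE x in lebesgue_on {0..1}. f x = c"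
proof -
  let ?M = "lebesgue_on {0..1::real}"
  have int: "integrable ?M \<psi>" "integrable ?M (\<lambda>x. \<psi> x * f x)" if "continuous_on UNIV \<psi>" for \<psi> :: "real \<Rightarrow> real"
  proof -
    have \<psi>: "continuous_on {0..1} \<psi>" using that by (rule continuous_on_subset) simp
    then show "integrable ?M \<psi>" by (rule continuous_integrable_unit)
    show "integrable ?M (\<lambda>x. \<psi> x * f x)"
      using integrable_bilinear_bounded[OF bounded_bilinear_mult f \<psi>] by (simp add: mult.commute)
  qed
  \<comment> \<open>No explicit bump function is built: if all means vanished, the constant 1 would
    be orthogonal to every admissible function and hence zero almost everywhere.\<close>
  have "\<exists>\<eta>. continuous_on UNIV \<eta> \<and> compactly_supported_01 \<eta> \<and> (LINT x|?M. \<eta> x) \<noteq> (0::real)"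
  proof (rule ccontr)
    assume "\<not> ?thesis"
    then have "AE x in ?M. (1::real) = 0"
      by (intro AE_zero_if_orthogonal) auto
    then show False
      by (simp add: trivial_limit_def[symmetric] ae_filter_eq_bot_iff emeasure_restrict_space)
  qed
  then obtain \<eta> where \<eta>: "continuous_on UNIV \<eta>" "compactly_supported_01 \<eta>" "(LINT x|?M. \<eta> x) \<noteq> (0::real)"
    by blast
  \<comment> \<open>The value for which f - c is orthogonal to \<eta>.\<close>
  define c where "c = (LINT x|?M. \<eta> x * f x) / (LINT x|?M. \<eta> x)"
  have "AE x in ?M. f x - c = 0"
  proof (rule AE_zero_if_orthogonal)
    show "integrable ?M (\<lambda>x. f x - c)" using f by simp
    fix \<psi> :: "real \<Rightarrow> real" assume \<psi>: "continuous_on UNIV \<psi>" "compactly_supported_01 \<psi>"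
    define r where "r = (LINT x|?M. \<psi> x) / (LINT x|?M. \<eta> x)"
    have "(LINT x|?M. \<psi> x - r * \<eta> x) = 0"
      using int[OF \<psi>(1)] int[OF \<eta>(1)] \<eta>(3) by (simp add: r_def)
    moreover have "continuous_on UNIV (\<lambda>x. \<psi> x - r * \<eta> x)"
      by (intro continuous_intros \<psi> \<eta>)
    moreover have "compactly_supported_01 (\<lambda>x. \<psi> x - r * \<eta> x)"
      by (rule compactly_supported_01_diff[OF \<psi>(2) \<eta>(2)])
    ultimately obtain \<phi> where "test_fun \<phi> (\<lambda>x. \<psi> x - r * \<eta> x)"
      using compactly_supported_primitive_test_fun by blast
    then have "(LINT x|?M. (\<psi> x - r * \<eta> x) * f x) = 0" by (rule orth)
    moreover have "(LINT x|?M. (\<psi> x - r * \<eta> x) * f x) =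
        (LINT x|?M. \<psi> x * f x) - r * (LINT x|?M. \<eta> x * f x)"
      using int[OF \<psi>(1)] int[OF \<eta>(1)] by (simp add: left_diff_distrib mult.assoc)
    ultimately have "(LINT x|?M. \<psi> x * f x) = c * (LINT x|?M. \<psi> x)"
      by (simp add: r_def c_def)
    then show "(LINT x|?M. \<psi> x * (f x - c)) = 0"
      using int[OF \<psi>(1)] by (simp add: right_diff_distrib)
  qed
  then show ?thesis by auto
qed

text \<open>The difference of \<open>w\<close> and a primitive of \<open>h\<close> has weak
  derivative zero: the boundary terms of the integration by parts vanish with the test function. The
  scalar du Bois-Reymond lemma then applies to each real coordinate.\<close>

lemma AE_eq_primitive_if_has_weak_deriv:
  fixes w h :: "real \<Rightarrow> complex^'n"
  assumes w: "integrable (lebesgue_on {0..1}) w" and h: "integrable (lebesgue_on {0..1}) h"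
    and weak: "has_weak_deriv w h"
  shows "\<exists>c. AE x in lebesgue_on {0..1}. w x = c + integral {0..x} h"
proof -
  let ?M = "lebesgue_on {0..1::real}"
  define f where "f x = w x - integral {0..x} h" for x
  have cont: "continuous_on {0..1} (\<lambda>x. integral {0..x} h)"
    by (rule continuous_on_indefinite_integral[OF h]) simp
  have int: "integrable ?M (\<lambda>x. integral {0..x} h)"
    by (rule continuous_integrable_unit[OF cont])
  have f: "integrable ?M f" unfolding f_def using w int by simp
  have orth: "(LINT x|?M. \<phi>' x *\<^sub>R f x) = 0" and test_int: "integrable ?M (\<lambda>x. \<phi>' x *\<^sub>R f x)"
    if \<phi>: "test_fun \<phi> \<phi>'" for \<phi> \<phi>'
  proof -
    have \<phi>': "continuous_on {0..1} \<phi>'"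
      using \<phi> unfolding test_fun_def by (blast intro: continuous_on_subset)
    have scale: "integrable ?M (\<lambda>x. \<phi>' x *\<^sub>R g x)" if "integrable ?M g" for g :: "real \<Rightarrow> complex^'n"
      using integrable_bilinear_bounded[OF bounded_bilinear.flip[OF bounded_bilinear_scaleR] that \<phi>'] .
    show "integrable ?M (\<lambda>x. \<phi>' x *\<^sub>R f x)" by (rule scale[OF f])
    obtain a b where "0 < a" "b < 1" "\<And>x. x \<notin> {a..b} \<Longrightarrow> \<phi> x = 0"
      using \<phi> unfolding test_fun_def by blast
    then have bdry: "\<phi> 0 = 0" "\<phi> 1 = 0" by auto
    have prim: "\<phi> x = \<phi> 0 + integral {0..x} \<phi>'" if x: "x \<in> {0..1}" for x
    proof -
      have "(\<phi> has_vector_derivative \<phi>' y) (at y within {0..x})" for y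
        using \<phi> unfolding test_fun_def has_real_derivative_iff_has_vector_derivative
        by (blast intro: has_vector_derivative_at_within)
      then have "(\<phi>' has_integral (\<phi> x - \<phi> 0)) {0..x}"
        using x by (intro fundamental_theorem_of_calculus) simp_all
      from integral_unique[OF this] show ?thesis by simp
    qed
    have "(LINT x|?M. \<phi>' x *\<^sub>R integral {0..x} h) + (LINT x|?M. \<phi> x *\<^sub>R h x) = 0"
    proof -
      have "(LINT x|?M. \<phi>' x *\<^sub>R integral {0..x} h) + (LINT x|?M. \<phi> x *\<^sub>R h x) =
          \<phi> 1 *\<^sub>R integral {0..1} h - \<phi> 0 *\<^sub>R integral {0..0} h"
        by (rule integration_by_parts_primitive[OF bounded_bilinear_scaleR
              continuous_integrable_unit[OF \<phi>'] h prim]) simp_all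
      then show ?thesis by (simp add: bdry)
    qed
    moreover have "(LINT x|?M. \<phi>' x *\<^sub>R w x) = - (LINT x|?M. \<phi> x *\<^sub>R h x)"
      using weak \<phi> unfolding has_weak_deriv_def by blast
    moreover have "(LINT x|?M. \<phi>' x *\<^sub>R f x) =
        (LINT x|?M. \<phi>' x *\<^sub>R w x) - (LINT x|?M. \<phi>' x *\<^sub>R integral {0..x} h)"
      unfolding f_def scaleR_right_diff_distrib
      by (rule Bochner_Integration.integral_diff[OF scale[OF w] scale[OF int]])
    ultimately show "(LINT x|?M. \<phi>' x *\<^sub>R f x) = 0" by (simp flip: eq_neg_iff_add_eq_0)
  qed
  have "\<exists>c. AE x in ?M. f x \<bullet> b = c" for b
  proof (rule AE_const_if_orthogonal_derivatives)
    show "integrable ?M (\<lambda>x. f x \<bullet> b)" using f by simp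
    fix \<phi> \<phi>' assume "test_fun \<phi> \<phi>'"
    then show "(LINT x|?M. \<phi>' x * (f x \<bullet> b)) = 0"
      using orth[of \<phi> \<phi>'] integral_inner_left[OF test_int, of b \<phi> \<phi>'] by simp
  qed
  then obtain c where c: "\<And>b. AE x in ?M. f x \<bullet> b = c b" by metis
  have "AE x in ?M. \<forall>b\<in>Basis. f x \<bullet> b = c b"
    using c by (intro AE_finite_allI) auto
  then have "AE x in ?M. w x = (\<Sum>b\<in>Basis. c b *\<^sub>R b) + integral {0..x} h"
  proof eventually_elim
    case (elim x)
    have "f x = (\<Sum>b\<in>Basis. c b *\<^sub>R b)"
      using elim by (subst euclidean_representation[of "f x", symmetric]) simp
    then show ?case by (simp add: f_def algebra_simps)
  qed
  then show ?thesis by blast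
qed

text \<open>A nonnegative continuous function with zero integral vanishes everywhere on the closed
  interval. Including the endpoints matters: boundary values are point evaluations on a null
  set.\<close>

lemma continuous_AE_eq_imp_eq:
  fixes f g :: "real \<Rightarrow> 'a::euclidean_space"
  assumes f: "continuous_on {0..1} f" and g: "continuous_on {0..1} g"
    and ae: "AE x in lebesgue_on {0..1}. f x = g x" and x: "x \<in> {0..1}"
  shows "f x = g x"
proof -
  let ?d = "\<lambda>x. norm (f x - g x)"
  have d: "continuous_on {0..1} ?d" using f g by (intro continuous_intros)
  have "(LINT x|lebesgue_on {0..1}. ?d x) = (LINT x|lebesgue_on {0..1::real}. 0)"
    using ae borel_measurable_integrable[OF continuous_integrable_unit[OF d]]
    by (intro integral_cong_AE) auto
  then have "integral {0..1} ?d = 0"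
    using integral_unit_interval_integral[OF continuous_integrable_unit[OF d]] by simp
  then have "(?d has_integral 0) (cbox 0 1)"
    using integrable_integral[OF integrable_continuous_interval[OF d]] by simp
  then have "?d x = 0"
    using x d by (intro has_integral_0_cbox_imp_0[of 0 1 ?d]) auto
  then show ?thesis by simp
qed

text \<open>Makes the choice in \<open>cont_rep\<close> computable: any continuous representative
  supplies its values on \<open>{0..1}\<close>.\<close>

lemma cont_rep_eqI:
  assumes "continuous_on {0..1} v" and "ae_eq_01 v w" and "x \<in> {0..1}"
  shows "cont_rep w x = v x"
proof -
  have "continuous_on {0..1} (cont_rep w) \<and> ae_eq_01 (cont_rep w) w"
    unfolding cont_rep_def by (rule someI[of _ v]) (use assms in simp)
  moreover from this have "AE x in lebesgue_on {0..1}. cont_rep w x = w x"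
    unfolding ae_eq_01_def by simp
  then have "AE x in lebesgue_on {0..1}. cont_rep w x = v x"
    using assms(2) unfolding ae_eq_01_def by eventually_elim simp
  ultimately show ?thesis
    using assms continuous_AE_eq_imp_eq by blast
qed

lemma L2_01_integrable:
  assumes "f \<in> L2_01"
  shows "integrable (lebesgue_on {0..1}) f"
proof (rule Bochner_Integration.integrable_bound)
  show "integrable (lebesgue_on {0..1}) (\<lambda>x. 1 + (norm (f x))\<^sup>2)"
    using assms by (simp add: L2_01_def)
  show "f \<in> borel_measurable (lebesgue_on {0..1})"
    using assms by (simp add: L2_01_def)
  have "t \<le> 1 + t\<^sup>2" for t :: real
  proof -
    have "2 * t \<le> t\<^sup>2 + 1" using zero_le_power2[of "t - 1"] unfolding power2_diff by simp
    then show ?thesis using zero_le_power2[of t] by linarith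
  qed
  then show "AE x in lebesgue_on {0..1}. norm (f x) \<le> norm (1 + (norm (f x))\<^sup>2)"
    by (intro AE_I2) (simp add: add_nonneg_nonneg abs_of_nonneg)
qed

text \<open>The primitive is taken of the very derivative selected by \<open>weak_deriv\<close>,
  since that is the function occurring in \<open>node_op\<close>.\<close>

lemma H1_01_cont_rep:
  assumes "w \<in> H1_01"
  shows "weak_deriv w \<in> L2_01" and "continuous_on {0..1} (cont_rep w)" and "ae_eq_01 (cont_rep w) w"
    and "\<And>x. x \<in> {0..1} \<Longrightarrow> cont_rep w x = cont_rep w 0 + integral {0..x} (weak_deriv w)"
proof -
  have w: "w \<in> L2_01" and exh: "\<exists>h. h \<in> L2_01 \<and> has_weak_deriv w h"
    using assms unfolding H1_01_def by auto
  from exh have h: "weak_deriv w \<in> L2_01 \<and> has_weak_deriv w (weak_deriv w)"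
    unfolding weak_deriv_def by (rule someI_ex)
  then show "weak_deriv w \<in> L2_01" by simp
  obtain c where c: "AE x in lebesgue_on {0..1}. w x = c + integral {0..x} (weak_deriv w)"
    using AE_eq_primitive_if_has_weak_deriv[OF L2_01_integrable L2_01_integrable] w h by blast
  let ?v = "\<lambda>x. c + integral {0..x} (weak_deriv w)"
  have v: "continuous_on {0..1} ?v"
    by (rule continuous_on_indefinite_integral[OF L2_01_integrable]) (use h in auto)
  have ae: "ae_eq_01 ?v w"
    using c unfolding ae_eq_01_def by (rule eventually_mono) simp
  have eq: "cont_rep w x = ?v x" if "x \<in> {0..1}" for x
    by (rule cont_rep_eqI[OF v ae that])
  show "continuous_on {0..1} (cont_rep w)"
    using v by (rule continuous_on_eq) (simp add: eq)
  show "ae_eq_01 (cont_rep w) w"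
    using ae AE_space[of "lebesgue_on {0..1}"] unfolding ae_eq_01_def
    by eventually_elim (use eq in auto)
  show "cont_rep w x = cont_rep w 0 + integral {0..x} (weak_deriv w)" if "x \<in> {0..1}" for x
    using eq[OF that] eq[of 0] by simp
qed

section \<open>The Riccati equation\<close>

lemma pos_mat_one: "pos_mat (mat 1)"
  by (simp add: pos_mat_def hermitian_def Re_cinner)

lemma care_P_ge_one:
  assumes "nonneg_mat \<Pi>\<^sub>0"
  shows "hermitian (care_P B D \<Pi>\<^sub>0)" and "(norm x)\<^sup>2 \<le> (care_P B D \<Pi>\<^sub>0 *v x) \<bullet> x"
proof -
  have adj: "adjoint_mat \<Pi>\<^sub>0 = \<Pi>\<^sub>0" and nonneg: "\<And>y. 0 \<le> Re (cinner (\<Pi>\<^sub>0 *v y) y)"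
    using assms by (auto simp add: nonneg_mat_def hermitian_def)
  show "hermitian (care_P B D \<Pi>\<^sub>0)"
    by (simp add: hermitian_def care_P_def adjoint_mat_add adjoint_mat_mult adj matrix_mul_assoc)
  have "cinner (care_P B D \<Pi>\<^sub>0 *v x) x =
      cinner x x + cinner (D *v x) (D *v x) + cinner (\<Pi>\<^sub>0 *v (B *v x)) (B *v x)"
    by (simp add: care_P_def matrix_vector_mult_add_rdistrib cinner_add_left cinner_matrix_right
        matrix_vector_mul_assoc[symmetric])
  then have "(care_P B D \<Pi>\<^sub>0 *v x) \<bullet> x =
      (norm x)\<^sup>2 + (norm (D *v x))\<^sup>2 + Re (cinner (\<Pi>\<^sub>0 *v (B *v x)) (B *v x))"
    by (simp add: Re_cinner[symmetric] cinner_self)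
  then show "(norm x)\<^sup>2 \<le> (care_P B D \<Pi>\<^sub>0 *v x) \<bullet> x"
    using nonneg[of "B *v x"] by simp
qed

lemma matrix_inv_mult:
  assumes "invertible A"
  shows "A ** matrix_inv A = mat 1" and "matrix_inv A ** A = mat 1"
  using someI_ex[OF assms[unfolded invertible_def]] by (simp_all add: matrix_inv_def)

lemma matrix_inv_unique:
  fixes A B :: "complex^'n^'n"
  assumes "A ** B = mat 1"
  shows "matrix_inv A = B"
proof -
  have "invertible A" using assms by (auto simp add: invertible_right_inverse)
  then have "matrix_inv A ** A = mat 1" by (simp add: matrix_inv_mult)
  then show ?thesis
    by (metis assms matrix_mul_assoc matrix_mul_lid matrix_mul_rid)
qed

text \<open>Here \<open>a\<close> stands for the value at 1 and \<open>A *v a + B *v u\<close> for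
  the value at 0. Expanding the right-hand side gives a term with the inverse of \<open>P\<close>,
  two cross terms and <P u, u>. The algebraic Riccati equation rewrites the first; the definitions
  of \<open>V\<close> and \<open>P\<close> rewrite the others.\<close>

lemma care_complete_square:
  assumes sol: "care_solution A B C D \<Pi>\<^sub>0"
    and P: "P = care_P B D \<Pi>\<^sub>0" and V: "V = care_V A B C D \<Pi>\<^sub>0"
  shows "cinner (\<Pi>\<^sub>0 *v (A *v a + B *v u)) (A *v a + B *v u) - cinner (\<Pi>\<^sub>0 *v a) a
      + complex_of_real ((norm (C *v a + D *v u))\<^sup>2) + cinner u u =
    complex_of_real ((norm (matrix_inv (sqrt_mat P) *v (V *v a) + sqrt_mat P *v u))\<^sup>2)"
proof -
  have nonneg: "nonneg_mat \<Pi>\<^sub>0"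
    and care: "adjoint_mat A ** \<Pi>\<^sub>0 ** A - \<Pi>\<^sub>0 + adjoint_mat C ** C = adjoint_mat V ** matrix_inv P ** V"
    using sol unfolding care_solution_def P V by auto
  have adj_Pi: "adjoint_mat \<Pi>\<^sub>0 = \<Pi>\<^sub>0"
    using nonneg by (simp add: nonneg_mat_def hermitian_def)
  define Q where "Q = sqrt_mat P"
  have Qpos: "pos_mat Q" and QQ: "Q ** Q = P"
    unfolding Q_def P by (rule sqrt_mat_ge_one[OF care_P_ge_one[OF nonneg]])+
  have adjQ: "adjoint_mat Q = Q" using Qpos by (simp add: pos_mat_def hermitian_def)
  let ?I = "matrix_inv Q"
  have inv: "Q ** ?I = mat 1" "?I ** Q = mat 1"
    using pos_mat_invertible[OF Qpos] by (simp_all add: matrix_inv_mult)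
  \<comment> \<open>As \<open>Q\<close> is Hermitian, the adjoint of its inverse is again a right
    inverse, so the inverse is Hermitian.\<close>
  have "Q ** adjoint_mat ?I = adjoint_mat (?I ** Q)" by (simp add: adjoint_mat_mult adjQ)
  then have "Q ** adjoint_mat ?I = mat 1" by (simp add: inv)
  then have adjI: "adjoint_mat ?I = ?I" by (rule matrix_inv_unique[symmetric])
  have "P ** (?I ** ?I) = Q ** (Q ** ?I) ** ?I" unfolding QQ[symmetric] by (simp only: matrix_mul_assoc)
  then have invP: "matrix_inv P = ?I ** ?I" using inv by (intro matrix_inv_unique) simp
  have cancel: "?I *v (Q *v x) = x" "Q *v (?I *v x) = x" for x
    using inv by (simp_all add: matrix_vector_mul_assoc)
  have Px: "P *v x = Q *v (Q *v x)" and invPx: "matrix_inv P *v x = ?I *v (?I *v x)" for x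
    unfolding invP by (simp_all add: QQ matrix_vector_mul_assoc)
  have "complex_of_real ((norm (?I *v (V *v a) + Q *v u))\<^sup>2) =
      cinner (matrix_inv P *v (V *v a)) (V *v a) + cinner (V *v a) u + cinner u (V *v a) + cinner (P *v u) u"
    by (simp add: cinner_self[symmetric] cinner_add_left cinner_add_right cinner_matrix_right[of _ Q]
        cinner_matrix_right[of _ ?I] adjQ adjI cancel Px invPx matrix_vector_right_distrib del: of_real_power)
  also have "cinner (matrix_inv P *v (V *v a)) (V *v a) = cinner ((adjoint_mat V ** matrix_inv P ** V) *v a) a"
    by (simp add: cinner_matrix_right matrix_vector_mul_assoc[symmetric])
  also have "\<dots> = cinner (\<Pi>\<^sub>0 *v (A *v a)) (A *v a) - cinner (\<Pi>\<^sub>0 *v a) a + cinner (C *v a) (C *v a)"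
    unfolding care[symmetric]
    by (simp add: cinner_matrix_right matrix_vector_mul_assoc[symmetric] cinner_add_left cinner_diff_left
        matrix_vector_mult_add_rdistrib matrix_vector_mult_diff_rdistrib)
  also have "cinner (V *v a) u = cinner (C *v a) (D *v u) + cinner (\<Pi>\<^sub>0 *v (A *v a)) (B *v u)"
    by (simp add: V care_V_def cinner_matrix_right matrix_vector_mul_assoc[symmetric] cinner_add_left
        matrix_vector_mult_add_rdistrib)
  also have "cinner u (V *v a) = cinner (D *v u) (C *v a) + cinner (\<Pi>\<^sub>0 *v (B *v u)) (A *v a)"
    by (simp add: V care_V_def cinner_matrix_left adj_Pi matrix_vector_mul_assoc[symmetric] cinner_add_right
        matrix_vector_mult_add_rdistrib)
  also have "cinner (P *v u) u = cinner u u + cinner (D *v u) (D *v u) + cinner (\<Pi>\<^sub>0 *v (B *v u)) (B *v u)"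
    by (simp add: P care_P_def matrix_vector_mult_add_rdistrib cinner_add_left cinner_matrix_right
        matrix_vector_mul_assoc[symmetric])
  finally show ?thesis
    unfolding Q_def cinner_self[symmetric]
    by (simp add: matrix_vector_right_distrib cinner_add_left cinner_add_right)
qed

text \<open>The form is conjugate-linear in \<open>g\<close>, but \<open>bounded_bilinear\<close>
  refers to real scalars, where conjugation is harmless; boundedness is automatic in finite
  dimension.\<close>

lemma bounded_bilinear_cinner_matrix:
  "bounded_bilinear (\<lambda>f g. cinner ((M :: complex^'n^'n) *v f) g)"
proof -
  have "bilinear (\<lambda>f g. cinner (M *v f) g)"
    unfolding bilinear_def
    by (auto intro!: linearI simp add: matrix_vector_right_distrib cinner_add_left cinner_add_right
        cinner_scaleR_left cinner_scaleR_right scaleR_conv_of_real[where 'a = complex]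
        matrix_vector_mult_scaleR_right)
  then show ?thesis by (simp add: bilinear_conv_bounded_bilinear)
qed

section \<open>Multiplication by a constant matrix as an operator on X\<close>

lemma matrix_vector_mult_L2_01:
  fixes M :: "complex^'n^'n"
  assumes f: "f \<in> L2_01"
  shows "(\<lambda>x. M *v f x) \<in> L2_01"
proof -
  obtain c where c: "1 \<le> c" "\<And>x. norm (M *v x) \<le> c * norm x"
    using matrix_norm_pos_bounded by blast
  have [measurable]: "f \<in> borel_measurable (lebesgue_on {0..1})"
    and int: "integrable (lebesgue_on {0..1}) (\<lambda>x. (norm (f x))\<^sup>2)"
    using f by (auto simp add: L2_01_def)
  have [measurable]: "(\<lambda>x. M *v f x) \<in> borel_measurable (lebesgue_on {0..1})"
    by (rule borel_measurable_continuous_on[of "\<lambda>y. M *v y"])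
      (simp_all add: linear_continuous_on)
  have "integrable (lebesgue_on {0..1}) (\<lambda>x. (norm (M *v f x))\<^sup>2)"
  proof (rule Bochner_Integration.integrable_bound)
    show "integrable (lebesgue_on {0..1}) (\<lambda>x. c\<^sup>2 * (norm (f x))\<^sup>2)" using int by simp
    show "AE x in lebesgue_on {0..1}. norm ((norm (M *v f x))\<^sup>2) \<le> norm (c\<^sup>2 * (norm (f x))\<^sup>2)"
      using c(2) by (intro AE_I2) (simp add: power_mult_distrib[symmetric] power_mono)
  qed measurable
  then show ?thesis by (simp add: L2_01_def)
qed

lemma norm_X_eq: "norm_X lam f = sqrt (LINT x|lebesgue_on {0..1}. lam x * (norm (f x))\<^sup>2)"
proof -
  have "inner_X lam f f = (LINT x|lebesgue_on {0..1}. complex_of_real (lam x * (norm (f x))\<^sup>2))"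
    by (simp add: inner_X_def cinner_self)
  also have "\<dots> = complex_of_real (LINT x|lebesgue_on {0..1}. lam x * (norm (f x))\<^sup>2)"
    by (rule integral_complex_of_real)
  finally show ?thesis by (simp add: norm_X_def)
qed

lemma bounded_op_X_matrix:
  fixes M :: "complex^'n^'n"
  assumes lam: "lam \<in> borel_measurable (lebesgue_on {0..1})" "bounded (lam ` {0..1})"
    and nonneg: "\<And>x. x \<in> {0..1} \<Longrightarrow> 0 \<le> lam x"
  shows "bounded_op_X lam (\<lambda>f x. M *v f x)"
proof -
  let ?M = "lebesgue_on {0..1::real}"
  note [measurable] = lam(1)
  obtain c where c: "1 \<le> c" "\<And>x. norm (M *v x) \<le> c * norm x"
    using matrix_norm_pos_bounded by blast
  obtain b where b: "\<And>x. x \<in> {0..1} \<Longrightarrow> \<bar>lam x\<bar> \<le> b"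
    using lam(2) unfolding bounded_iff by fastforce
  have int: "integrable ?M (\<lambda>x. lam x * (norm (f x))\<^sup>2)" if "f \<in> L2_01" for f :: "real \<Rightarrow> complex^'n"
  proof (rule Bochner_Integration.integrable_bound)
    have [measurable]: "f \<in> borel_measurable ?M" using that by (simp add: L2_01_def)
    show "integrable ?M (\<lambda>x. b * (norm (f x))\<^sup>2)" using that by (simp add: L2_01_def)
    show "(\<lambda>x. lam x * (norm (f x))\<^sup>2) \<in> borel_measurable ?M" by measurable
    show "AE x in ?M. norm (lam x * (norm (f x))\<^sup>2) \<le> norm (b * (norm (f x))\<^sup>2)"
    proof (rule AE_I2)
      fix x assume "x \<in> space ?M"
      then have "\<bar>lam x\<bar> \<le> \<bar>b\<bar>" using b[of x] by simp
      then show "norm (lam x * (norm (f x))\<^sup>2) \<le> norm (b * (norm (f x))\<^sup>2)"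
        by (simp add: abs_mult mult_right_mono)
    qed
  qed
  \<comment> \<open>The pointwise operator bound of the matrix survives integration with the same
    constant, because the weight is a nonnegative scalar; boundedness of the weight enters through
    integrability only.\<close>
  have "norm_X lam (\<lambda>x. M *v f x) \<le> c * norm_X lam f" if f: "f \<in> L2_01" for f
  proof -
    have "(LINT x|?M. lam x * (norm (M *v f x))\<^sup>2) \<le> (LINT x|?M. c\<^sup>2 * (lam x * (norm (f x))\<^sup>2))"
    proof (rule integral_mono)
      show "integrable ?M (\<lambda>x. lam x * (norm (M *v f x))\<^sup>2)"
        by (rule int[OF matrix_vector_mult_L2_01[OF f]])
      show "integrable ?M (\<lambda>x. c\<^sup>2 * (lam x * (norm (f x))\<^sup>2))" using int[OF f] by simp
      fix x assume "x \<in> space ?M"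
      then have "lam x * (norm (M *v f x))\<^sup>2 \<le> lam x * (c * norm (f x))\<^sup>2"
        using nonneg c(2) by (intro mult_left_mono power_mono) auto
      then show "lam x * (norm (M *v f x))\<^sup>2 \<le> c\<^sup>2 * (lam x * (norm (f x))\<^sup>2)"
        by (simp add: power_mult_distrib algebra_simps)
    qed
    also have "\<dots> = c\<^sup>2 * (LINT x|?M. lam x * (norm (f x))\<^sup>2)" by simp
    finally have "norm_X lam (\<lambda>x. M *v f x) \<le> sqrt (c\<^sup>2 * (LINT x|?M. lam x * (norm (f x))\<^sup>2))"
      unfolding norm_X_eq by (rule real_sqrt_le_mono)
    also have "\<dots> = c * norm_X lam f"
      using c(1) by (simp add: real_sqrt_mult norm_X_eq)
    finally show ?thesis .
  qed
  then show ?thesis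
    unfolding bounded_op_X_def
    by (auto simp add: matrix_vector_mult_L2_01 ae_eq_01_def matrix_vector_right_distrib vector_scalar_commute)
qed

lemma self_adjoint_X_matrix:
  assumes "hermitian M"
  shows "self_adjoint_X lam (\<lambda>f x. M *v f x)"
  using assms by (simp add: self_adjoint_X_def inner_X_def cinner_matrix_left hermitian_def)

text \<open>The corresponding combination of continuous representatives is itself a continuous
  representative, and \<open>cont_rep_eqI\<close> identifies its values.\<close>

lemma boundary_value_linear:
  assumes "weighted lam z \<in> H1_01" and "weighted lam z' \<in> H1_01" and "x \<in> {0..1}"
  shows "boundary_value lam (\<lambda>\<zeta>. a *s z \<zeta> + b *s z' \<zeta>) x =
    a *s boundary_value lam z x + b *s boundary_value lam z' x"
  unfolding boundary_value_def
proof (rule cont_rep_eqI)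
  let ?v = "cont_rep (weighted lam z)" and ?v' = "cont_rep (weighted lam z')"
  have smult: "continuous_on {0..1} (\<lambda>x. c *s f x)" if "continuous_on {0..1} f" for c and f :: "real \<Rightarrow> complex^'n"
    unfolding vector_scalar_mult_def by (intro continuous_intros that)
  show "continuous_on {0..1} (\<lambda>x. a *s ?v x + b *s ?v' x)"
    by (intro continuous_on_add smult H1_01_cont_rep assms)
  show "ae_eq_01 (\<lambda>x. a *s ?v x + b *s ?v' x) (weighted lam (\<lambda>\<zeta>. a *s z \<zeta> + b *s z' \<zeta>))"
    using H1_01_cont_rep(3)[OF assms(1)] H1_01_cont_rep(3)[OF assms(2)] unfolding ae_eq_01_def
    by eventually_elim
      (simp add: weighted_def vec_eq_iff scaleR_conv_of_real[where 'a = complex] algebra_simps)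
qed (rule assms)

lemma boundary_value_cong:
  assumes "weighted lam z \<in> H1_01" and "ae_eq_01 z z'" and "x \<in> {0..1}"
  shows "boundary_value lam z' x = boundary_value lam z x"
  unfolding boundary_value_def
proof (rule cont_rep_eqI)
  show "ae_eq_01 (cont_rep (weighted lam z)) (weighted lam z')"
    using H1_01_cont_rep(3)[OF assms(1)] assms(2) unfolding ae_eq_01_def
    by eventually_elim (simp add: weighted_def)
qed (use assms H1_01_cont_rep(2) in auto)

text \<open>The weight is absorbed into \<open>z\<close>, and \<open>M\<close>, being Hermitian,
  moves to the left slot, so both inner products become integrals of a single bilinear form.
  Integration by parts with \<open>g\<close> in both roles gives the boundary terms; the minus sign
  of the transport operator puts the value at 0 first.\<close>

lemma inner_X_derivative:
  fixes M :: "complex^'n^'n"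
  assumes M: "hermitian M" and H1: "weighted lam z \<in> H1_01"
  defines "h \<equiv> weak_deriv (weighted lam z)" and "g \<equiv> boundary_value lam z"
  shows "inner_X lam (\<lambda>\<zeta>. - h \<zeta>) (\<lambda>\<zeta>. M *v z \<zeta>) + inner_X lam (\<lambda>\<zeta>. M *v z \<zeta>) (\<lambda>\<zeta>. - h \<zeta>) =
    cinner (M *v g 0) (g 0) - cinner (M *v g 1) (g 1)"
proof -
  let ?M = "lebesgue_on {0..1::real}"
  let ?w = "weighted lam z"
  let ?B = "\<lambda>f g. cinner (M *v f) g"
  have g: "g = cont_rep ?w" by (simp add: g_def boundary_value_def fun_eq_iff)
  have h: "h \<in> L2_01" and contg: "continuous_on {0..1} g" and ae: "AE x in ?M. g x = ?w x"
    and prim: "\<And>x. x \<in> {0..1} \<Longrightarrow> g x = g 0 + integral {0..x} h"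
    unfolding h_def g by (rule H1_01_cont_rep[OF H1, unfolded ae_eq_01_def]; assumption?)+
  have adj: "cinner x (M *v y) = cinner (M *v x) y" for x y
    using M by (simp add: cinner_matrix_right hermitian_def)
  have hm: "h \<in> borel_measurable ?M" and wm: "?w \<in> borel_measurable ?M"
    using h H1 by (auto simp add: L2_01_def H1_01_def)
  have gm: "g \<in> borel_measurable ?M"
    by (rule borel_measurable_integrable[OF continuous_integrable_unit[OF contg]])
  note meas = borel_measurable_bilinear[OF bounded_bilinear_cinner_matrix[of M]]
  have "inner_X lam (\<lambda>\<zeta>. - h \<zeta>) (\<lambda>\<zeta>. M *v z \<zeta>) = - (LINT x|?M. ?B (h x) (?w x))"
    by (simp add: inner_X_def adj cinner_minus_left cinner_scaleR_right weighted_def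
        matrix_vector_mult_minus_right)
  \<comment> \<open>Only \<open>g\<close>, not the product of weight and state, satisfies the
    primitive formula at every point, so it has to be substituted under the integral first.\<close>
  also have "(LINT x|?M. ?B (h x) (?w x)) = (LINT x|?M. ?B (h x) (g x))"
  proof (intro integral_cong_AE meas hm wm gm)
    show "AE x in ?M. ?B (h x) (?w x) = ?B (h x) (g x)"
      using ae by (rule eventually_mono) simp
  qed
  finally have 1: "inner_X lam (\<lambda>\<zeta>. - h \<zeta>) (\<lambda>\<zeta>. M *v z \<zeta>) = - (LINT x|?M. ?B (h x) (g x))" .
  have "inner_X lam (\<lambda>\<zeta>. M *v z \<zeta>) (\<lambda>\<zeta>. - h \<zeta>) = - (LINT x|?M. ?B (?w x) (h x))"
    by (simp add: inner_X_def cinner_minus_right cinner_scaleR_left weighted_def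
        matrix_vector_mult_scaleR_right)
  also have "(LINT x|?M. ?B (?w x) (h x)) = (LINT x|?M. ?B (g x) (h x))"
  proof (intro integral_cong_AE meas hm wm gm)
    show "AE x in ?M. ?B (?w x) (h x) = ?B (g x) (h x)"
      using ae by (rule eventually_mono) simp
  qed
  finally have 2: "inner_X lam (\<lambda>\<zeta>. M *v z \<zeta>) (\<lambda>\<zeta>. - h \<zeta>) = - (LINT x|?M. ?B (g x) (h x))" .
  have "(LINT x|?M. ?B (h x) (g x)) + (LINT x|?M. ?B (g x) (h x)) = ?B (g 1) (g 1) - ?B (g 0) (g 0)"
    by (rule integration_by_parts_primitive[OF bounded_bilinear_cinner_matrix
          L2_01_integrable[OF h] L2_01_integrable[OF h] prim prim])
  then show ?thesis unfolding 1 2 by (simp add: algebra_simps)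
qed

theorem theorem1:
  fixes lam :: "real \<Rightarrow> real" and \<epsilon> :: real
    and K L :: "complex^'n::{finite,linorder}^'n::{finite,linorder}"
    and Ky Ly :: "complex^'n::{finite,linorder}^'m"
    and A \<Pi>\<^sub>0 :: "complex^'n::{finite,linorder}^'n::{finite,linorder}"
    and B :: "complex^'p::{finite,linorder}^'n::{finite,linorder}"
    and C :: "complex^'n::{finite,linorder}^'m"
    and D :: "complex^'p::{finite,linorder}^'m"
    and P :: "complex^'p::{finite,linorder}^'p::{finite,linorder}"
    and V :: "complex^'n::{finite,linorder}^'p::{finite,linorder}"
  assumes "CARD('p) \<le> CARD('n)"
    and "lam \<in> borel_measurable (lebesgue_on {0..1})"
    and "bounded (lam ` {0..1})"
    and "\<epsilon> > 0" and "\<And>\<zeta>. \<zeta> \<in> {0..1} \<Longrightarrow> lam \<zeta> \<ge> \<epsilon>"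
    and "invertible K"
    and "A = disc_A K L" and "B = disc_B K" and "C = disc_C K L Ky Ly" and "D = disc_D K Ky"
    and "care_smallest_solution A B C D \<Pi>\<^sub>0"
    and "P = care_P B D \<Pi>\<^sub>0" and "V = care_V A B C D \<Pi>\<^sub>0"
  shows "riccati_solution lam (node_dom lam A B) (node_op lam C D) (mat 1)
           (\<lambda>z \<zeta>. \<Pi>\<^sub>0 *v z \<zeta>)
           (\<lambda>(z, u). matrix_inv (sqrt_mat P) *v (V *v boundary_value lam z 1) + sqrt_mat P *v u)"
    (is "riccati_solution lam ?Dom ?S _ ?Z ?KL")
proof -
  have sol: "care_solution A B C D \<Pi>\<^sub>0"
    using assms(11) by (simp add: care_smallest_solution_def)
  then have herm: "hermitian \<Pi>\<^sub>0" by (simp add: care_solution_def nonneg_mat_def)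
  have "bounded_op_X lam ?Z"
  proof (rule bounded_op_X_matrix[OF assms(2,3)])
    show "0 \<le> lam x" if "x \<in> {0..1}" for x using assms(4) assms(5)[OF that] by simp
  qed
  moreover have "self_adjoint_X lam ?Z" by (rule self_adjoint_X_matrix[OF herm])
  moreover have "linear_op_on ?Dom ?KL"
    unfolding linear_op_on_def
  proof (intro conjI allI impI)
    fix z u z' u' and a b :: complex
    assume "(z, u) \<in> ?Dom" "(z', u') \<in> ?Dom"
    then have "boundary_value lam (\<lambda>\<zeta>. a *s z \<zeta> + b *s z' \<zeta>) 1 =
        a *s boundary_value lam z 1 + b *s boundary_value lam z' 1"
      by (intro boundary_value_linear) (simp_all add: node_dom_def)
    then show "?KL (\<lambda>\<zeta>. a *s z \<zeta> + b *s z' \<zeta>, a *s u + b *s u') = a *s ?KL (z, u) + b *s ?KL (z', u')"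
      by (simp add: matrix_vector_right_distrib vector_scalar_commute vector_add_ldistrib)
  next
    fix z z' u
    assume "(z, u) \<in> ?Dom" "ae_eq_01 z z'"
    then have "boundary_value lam z' 1 = boundary_value lam z 1"
      by (intro boundary_value_cong) (simp_all add: node_dom_def)
    then show "?KL (z, u) = ?KL (z', u)" by simp
  qed
  moreover have "inner_X lam (fst (?S (z, u))) (?Z z) + inner_X lam (?Z z) (fst (?S (z, u)))
        + complex_of_real ((norm (snd (?S (z, u))))\<^sup>2) + cinner (mat 1 *v u) u
        = complex_of_real ((norm (?KL (z, u)))\<^sup>2)" if "(z, u) \<in> ?Dom" for z u
  proof -
    let ?g = "boundary_value lam z"
    have H1: "weighted lam z \<in> H1_01" and g0: "?g 0 = A *v ?g 1 + B *v u"
      using that by (auto simp add: node_dom_def algebra_simps)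
    show ?thesis
      \<comment> \<open>With the node's boundary condition solved for the value at 0, the boundary
        terms are exactly the first two terms on the left of the completed square at a = g(1); the
        output norm and the input term for R = I match the remaining two.\<close>
      using inner_X_derivative[OF herm H1] care_complete_square[OF sol assms(12,13), of "?g 1" u]
      by (simp add: node_op_def g0)
  qed
  ultimately show ?thesis unfolding riccati_solution_def using pos_mat_one by blast
qed

end
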